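(* Let $G=(V,E)$ be a connected simple graph with $n=|V|$, $m=|E|$, and $m\ge n$. The expected number of random variables sampled in the bicycle-popping algorithm on $G$ is at most $2n^2-n$.
   Context: Bicycle-popping: to each vertex $v$ associate a random variable $a_v=(v,w)$, an arc from $v$ to a uniformly random neighbour $w$ of $v$. Bad events: for each edge $e=\{u,v\}$, $B_e$ is the event that $a_u=(u,v)$ and $a_v=(v,u)$; for each cycle $C$ of $G$ (length at least 3) an orientation is fixed arbitrarily in advance and $B_C$ is the event that each $a_v$, $v\in C$, is the arc leaving $v$ along $C$ in that orientation. The algorithm samples all $a_v$ independently; while some bad event occurs, it lets $\mathsf{Bad}$ be the set of vertices contained in some edge or cycle whose bad event occurs and resamples $a_v$ for all $v\in\mathsf{Bad}$; finally it outputs the undirected edges $\{v,w\}$ with $a_v=(v,w)$. The count in the claim is the number of resampled variables (each resampling of each variable counted once). *)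

theory Defs
  imports "HOL-Probability.Probability"
begin

definition simple_graph :: "'a set \<Rightarrow> 'a set set \<Rightarrow> bool" where
  "simple_graph V E \<longleftrightarrow> finite V \<and> (\<forall>e\<in>E. e \<subseteq> V \<and> card e = 2)"

definition connected_graph :: "'a set \<Rightarrow> 'a set set \<Rightarrow> bool" where
  "connected_graph V E \<longleftrightarrow> V \<noteq> {} \<and> (\<forall>u\<in>V. \<forall>v\<in>V. (u, v) \<in> {(x, y). {x, y} \<in> E}\<^sup>*)"

definition neighbours :: "'a set set \<Rightarrow> 'a \<Rightarrow> 'a set" where
  "neighbours E v = {w. {v, w} \<in> E}"

(* A vertex list stands for the closed walk that follows it and then returns to its head. *)

definition cycle_arcs :: "'a list \<Rightarrow> ('a \<times> 'a) set" where
  "cycle_arcs xs = set (zip xs (rotate1 xs))"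

definition cycle_edges :: "'a list \<Rightarrow> 'a set set" where
  "cycle_edges xs = (\<lambda>(u, v). {u, v}) ` cycle_arcs xs"

definition cycle_walk :: "'a set set \<Rightarrow> 'a list \<Rightarrow> bool" where
  "cycle_walk E xs \<longleftrightarrow> length xs \<ge> 3 \<and> distinct xs \<and> cycle_edges xs \<subseteq> E"

(* A cycle is an unoriented subgraph without a base point, identified with its edge set. *)

definition cycles :: "'a set set \<Rightarrow> 'a set set set" where
  "cycles E = {cycle_edges xs | xs. cycle_walk E xs}"

(* An arbitrary choice, for every cycle, of one of its two directed versions. *)

definition cycle_orientation :: "'a set set \<Rightarrow> ('a set set \<Rightarrow> ('a \<times> 'a) set) \<Rightarrow> bool" where
  "cycle_orientation E orient \<longleftrightarrow>
     (\<forall>C\<in>cycles E. \<exists>xs. cycle_walk E xs \<and> cycle_edges xs = C \<and> orient C = cycle_arcs xs)"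

(* The arc variable a_v = (v, w) is encoded by its endpoint: a v = w. *)

definition edge_event :: "('a \<Rightarrow> 'a) \<Rightarrow> 'a set \<Rightarrow> bool" where
  "edge_event a e \<longleftrightarrow> (\<exists>u v. e = {u, v} \<and> a u = v \<and> a v = u)"

definition cycle_event ::
  "('a set set \<Rightarrow> ('a \<times> 'a) set) \<Rightarrow> ('a \<Rightarrow> 'a) \<Rightarrow> 'a set set \<Rightarrow> bool" where
  "cycle_event orient a C \<longleftrightarrow> (\<forall>(v, w)\<in>orient C. a v = w)"

definition Bad ::
  "'a set set \<Rightarrow> ('a set set \<Rightarrow> ('a \<times> 'a) set) \<Rightarrow> ('a \<Rightarrow> 'a) \<Rightarrow> 'a set" where
  "Bad E orient a =
     \<Union>{e \<in> E. edge_event a e} \<union> \<Union>(\<Union>{C \<in> cycles E. cycle_event orient a C})"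

definition arc_pmf :: "'a set \<Rightarrow> 'a set set \<Rightarrow> ('a \<Rightarrow> 'a) pmf" where
  "arc_pmf V E = Pi_pmf V undefined (\<lambda>v. pmf_of_set (neighbours E v))"

(* The randomness of one execution: an i.i.d. sequence of fresh samples of all arc variables.
   Entry 0 is the initial sample; a later entry is read only at the vertices resampled in
   that round. *)

definition sample_space :: "'a set \<Rightarrow> 'a set set \<Rightarrow> ('a \<Rightarrow> 'a) stream measure" where
  "sample_space V E = stream_space (measure_pmf (arc_pmf V E))"

(* The loop stops exactly when Bad is empty; from then on the state is constant here. *)

primrec bicycle_popping ::
  "'a set set \<Rightarrow> ('a set set \<Rightarrow> ('a \<times> 'a) set) \<Rightarrow> ('a \<Rightarrow> 'a) stream \<Rightarrow> nat \<Rightarrow> 'a \<Rightarrow> 'a" where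
  "bicycle_popping E orient \<omega> 0 = \<omega> !! 0"
| "bicycle_popping E orient \<omega> (Suc t) =
     (let a = bicycle_popping E orient \<omega> t
      in (\<lambda>v. if v \<in> Bad E orient a then (\<omega> !! Suc t) v else a v))"

(* Rounds after termination contribute 0; the initial sample is not counted. The value is
   infinite if the loop does not terminate. *)

definition num_resampled ::
  "'a set set \<Rightarrow> ('a set set \<Rightarrow> ('a \<times> 'a) set) \<Rightarrow> ('a \<Rightarrow> 'a) stream \<Rightarrow> ennreal" where
  "num_resampled E orient \<omega> = (\<Sum>t. of_nat (card (Bad E orient (bicycle_popping E orient \<omega> t))))"

end

theory Submission
  imports Defs "HOL-Combinatorics.Orbits"
begin

text \<open>Two distinct bad events that can occur together have disjoint vertex sets, so the algorithm is
  partial rejection sampling for an extremal instance. The law of the configuration after each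
  round has a density depending only on the set of bad cycles, and averaged over
  such laws an explicit potential decreases in each round by exactly the number of resampled
  variables; its initial mean is \<open>E[|C|; C is the only bad cycle] / P(no bad cycle)\<close>.

  The ratio is estimated by counting. If the unique bad cycle has length at least 3, reversing it
  gives a good configuration, from which it is recovered by one of its vertices: this
  contributes at most \<open>n\<close>. If it is an edge, the configuration is determined by this edge and the
  set of the \<open>n - 1\<close> edges used, and such an edge set arises from a good configuration by deleting
  one of its \<open>n\<close> edges: this contributes at most \<open>2 (n - 1) n\<close>.\<close>

section \<open>Partial rejection sampling for extremal instances\<close>

text \<open>The potential comes from a bookkeeping heuristic. The ratio
  \<open>single_weight T / good_weight T\<close> is the ratio of the whole instance, formed for the
  bad events disjoint from \<open>\<Union>T\<close> alone, so it should be the cost of removing just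
  those. When exactly the events of \<open>T\<close> occur and are resampled, nothing away from
  \<open>T\<close> is bad: that share of the total \<open>single_weight {} / good_weight {}\<close>
  is already paid and only the difference remains. Adding \<open>card (\<Union>T)\<close> for the
  round itself gives \<open>potential\<close>, which is 0 when nothing is bad. Its sign is not
  evident from the formula, so telescoping alone does not bound the partial sums; the remainder is
  compared with the mean number of variables resampled in the following round. In the counting, a
  two-cycle is the difficult bad event because reversal leaves it unchanged. Removing it needs an
  edge not yet used. A configuration with a two-cycle uses at most \<open>card V - 1\<close> edges,
  so \<open>card E \<ge> card V\<close> leaves one over.\<close>

definition resample :: "'a set \<Rightarrow> ('a \<Rightarrow> 'b) \<Rightarrow> ('a \<Rightarrow> 'b) \<Rightarrow> 'a \<Rightarrow> 'b" where
  "resample B w a = (\<lambda>v. if v \<in> B then w v else a v)"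

text \<open>A bad event is represented by the set of its variables. The law is uniform on
  \<open>\<Omega>\<close>; closure under mixing two configurations (\<open>resample_in\<close>)
  takes the place of independence. Extremality is \<open>bad_disjoint\<close>: events sharing a
  variable never occur together.\<close>

locale extremal_instance =
  fixes V :: "'a set" and \<Omega> :: "('a \<Rightarrow> 'b) set" and bad :: "('a \<Rightarrow> 'b) \<Rightarrow> 'a set set"
  assumes finite_V: "finite V" and finite_\<Omega>: "finite \<Omega>"
    and resample_in: "a \<in> \<Omega> \<Longrightarrow> w \<in> \<Omega> \<Longrightarrow> resample B w a \<in> \<Omega>"
    and bad_subset: "a \<in> \<Omega> \<Longrightarrow> C \<in> bad a \<Longrightarrow> C \<subseteq> V"
    and bad_nonempty: "a \<in> \<Omega> \<Longrightarrow> C \<in> bad a \<Longrightarrow> C \<noteq> {}"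
    and bad_local: "a \<in> \<Omega> \<Longrightarrow> b \<in> \<Omega> \<Longrightarrow> C \<in> bad a \<Longrightarrow> (\<And>v. v \<in> C \<Longrightarrow> a v = b v) \<Longrightarrow> C \<in> bad b"
    and bad_disjoint: "a \<in> \<Omega> \<Longrightarrow> C \<in> bad a \<Longrightarrow> D \<in> bad a \<Longrightarrow> C \<inter> D \<noteq> {} \<Longrightarrow> C = D"
    and good_exists: "\<exists>a\<in>\<Omega>. bad a = {}"
begin

definition far :: "'a set set \<Rightarrow> ('a \<Rightarrow> 'b) \<Rightarrow> 'a set set" where
  "far T a = {C \<in> bad a. C \<inter> \<Union>T = {}}"

definition ways :: "'a set set \<Rightarrow> real" where
  "ways T = (\<Sum>w\<in>\<Omega>. of_bool (T \<subseteq> bad w))"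

definition good_weight :: "'a set set \<Rightarrow> real" where
  "good_weight T = (\<Sum>a\<in>\<Omega>. of_bool (far T a = {}))"

definition single_weight :: "'a set set \<Rightarrow> real" where
  "single_weight T = (\<Sum>a\<in>\<Omega>. of_bool (card (far T a) = 1) * real (card (\<Union>(far T a))))"

definition expected :: "(('a \<Rightarrow> 'b) \<Rightarrow> real) \<Rightarrow> ('a \<Rightarrow> 'b) \<Rightarrow> real" where
  "expected g a = (\<Sum>w\<in>\<Omega>. g (resample (\<Union>(bad a)) w a)) / card \<Omega>"

text \<open>The mean number of variables still to be resampled, given the current set of bad events.\<close>

definition potential :: "('a \<Rightarrow> 'b) \<Rightarrow> real" where
  "potential a = single_weight {} / good_weight {} + card (\<Union>(bad a))
     - single_weight (bad a) / good_weight (bad a)"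

text \<open>The adjoint of \<open>expected\<close> on densities of the form
  \<open>c (bad a)\<close>. A set \<open>U\<close> can arise from \<open>T\<close> only if every
  member of \<open>U\<close> meets \<open>\<Union>T\<close>, since events away from the resampled
  variables keep their status.\<close>

definition push :: "('a set set \<Rightarrow> real) \<Rightarrow> 'a set set \<Rightarrow> real" where
  "push c U = (\<Sum>T\<in>Pow (Pow V). c T * ways T * of_bool (\<forall>C\<in>U. C \<inter> \<Union>T \<noteq> {})) / card \<Omega>"

lemma bad_in_Pow: "a \<in> \<Omega> \<Longrightarrow> bad a \<in> Pow (Pow V)"
  using bad_subset by auto

lemma finite_bad: "a \<in> \<Omega> \<Longrightarrow> finite (bad a)"
  using bad_in_Pow finite_V by (meson PowD finite_Pow_iff finite_subset)

lemma finite_bad_member: "a \<in> \<Omega> \<Longrightarrow> C \<in> bad a \<Longrightarrow> finite C"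
  using bad_subset finite_V finite_subset by blast

lemma card_\<Omega>_pos: "card \<Omega> > 0"
  using good_exists finite_\<Omega> by (auto simp: card_gt_0_iff)

lemma subset_bad_resample_iff:
  assumes "a \<in> \<Omega>" "w \<in> \<Omega>"
  shows "T \<subseteq> bad (resample (\<Union>T) w a) \<longleftrightarrow> T \<subseteq> bad w"
proof -
  have "C \<in> bad (resample (\<Union>T) w a) \<longleftrightarrow> C \<in> bad w" if "C \<in> T" for C
  proof -
    have eq: "resample (\<Union>T) w a v = w v" if "v \<in> C" for v
      using that \<open>C \<in> T\<close> by (auto simp: resample_def)
    show ?thesis
      using bad_local[OF resample_in[OF assms] assms(2)] bad_local[OF assms(2) resample_in[OF assms]]
        eq by metis
  qed
  then show ?thesis by blast
qed

lemma bad_resample_Diff: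
  assumes "a \<in> \<Omega>" "w \<in> \<Omega>" and T: "T \<subseteq> bad (resample (\<Union>T) w a)"
  shows "bad (resample (\<Union>T) w a) - T = far T a"
proof -
  let ?b = "resample (\<Union>T) w a"
  have b: "?b \<in> \<Omega>" using resample_in assms by blast
  have eq: "?b v = a v" if "v \<in> C" "C \<inter> \<Union>T = {}" for v C
    using that by (auto simp: resample_def)
  show ?thesis
  proof (intro equalityI subsetI)
    fix D assume D: "D \<in> bad ?b - T"
    have disj: "D \<inter> \<Union>T = {}"
    proof (rule ccontr)
      assume "D \<inter> \<Union>T \<noteq> {}"
      then obtain C where "C \<in> T" "D \<inter> C \<noteq> {}" by blast
      then show False using bad_disjoint[OF b, of D C] D T by blast
    qed
    moreover have "D \<in> bad a"
      using bad_local[OF b assms(1), of D] D eq disj by blast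
    ultimately show "D \<in> far T a" by (simp add: far_def)
  next
    fix D assume "D \<in> far T a"
    then have D: "D \<in> bad a" "D \<inter> \<Union>T = {}" by (auto simp: far_def)
    then have "D \<in> bad ?b"
      using bad_local[OF assms(1) b, of D] eq by metis
    moreover have "D \<notin> T" using D bad_nonempty[OF assms(1) D(1)] by blast
    ultimately show "D \<in> bad ?b - T" by simp
  qed
qed

text \<open>Exchanging the values of two independent samples on the vertex set of \<open>T\<close> separates
  the occurrence of \<open>T\<close> from the part of the configuration away from \<open>T\<close>.\<close>

lemma swap_identity:
  fixes F :: "'a set set \<Rightarrow> ('a \<Rightarrow> 'b) \<Rightarrow> real"
  shows "(\<Sum>a\<in>\<Omega>. of_bool (T \<subseteq> bad a) * (\<Sum>w\<in>\<Omega>. F (bad a - T) (resample (\<Union>T) w a)))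
     = ways T * (\<Sum>a\<in>\<Omega>. F (far T a) a)"
proof -
  let ?r = "resample (\<Union>T)"
  define h where "h = (\<lambda>(a, w). of_bool (T \<subseteq> bad a) * F (bad a - T) (?r w a))"
  define \<sigma> :: "('a \<Rightarrow> 'b) \<times> ('a \<Rightarrow> 'b) \<Rightarrow> ('a \<Rightarrow> 'b) \<times> ('a \<Rightarrow> 'b)" where "\<sigma> = (\<lambda>(a, w). (?r w a, ?r a w))"
  have inv: "\<sigma> (\<sigma> p) = p" for p
    by (auto simp: \<sigma>_def resample_def split: prod.splits)
  have mem: "\<sigma> p \<in> \<Omega> \<times> \<Omega>" if "p \<in> \<Omega> \<times> \<Omega>" for p
    using that by (auto simp: \<sigma>_def resample_in)
  have "(\<Sum>a\<in>\<Omega>. of_bool (T \<subseteq> bad a) * (\<Sum>w\<in>\<Omega>. F (bad a - T) (?r w a)))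
    = (\<Sum>p\<in>\<Omega> \<times> \<Omega>. h p)"
    by (simp add: h_def sum.cartesian_product[symmetric] sum_distrib_left)
  also have "\<dots> = (\<Sum>p\<in>\<Omega> \<times> \<Omega>. h (\<sigma> p))"
    by (rule sum.reindex_bij_witness[of _ \<sigma> \<sigma>]) (auto simp: inv mem)
  also have "\<dots> = (\<Sum>(a, w)\<in>\<Omega> \<times> \<Omega>. of_bool (T \<subseteq> bad w) * F (far T a) a)"
  proof (rule sum.cong[OF refl], clarify)
    fix a w assume aw: "a \<in> \<Omega>" "w \<in> \<Omega>"
    have "?r (?r a w) (?r w a) = a" by (auto simp: resample_def)
    then show "h (\<sigma> (a, w)) = of_bool (T \<subseteq> bad w) * F (far T a) a"
      using subset_bad_resample_iff[OF aw, of T] bad_resample_Diff[OF aw, of T]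
      by (cases "T \<subseteq> bad w") (auto simp: h_def \<sigma>_def)
  qed
  also have "\<dots> = ways T * (\<Sum>a\<in>\<Omega>. F (far T a) a)"
    unfolding ways_def sum_product
    by (subst sum.swap) (simp add: sum.cartesian_product)
  finally show ?thesis .
qed

section \<open>Conditioning on the set of bad events\<close>

lemma sum_bad_eq:
  fixes h :: "('a \<Rightarrow> 'b) \<Rightarrow> real"
  shows "(\<Sum>a\<in>\<Omega>. h a) = (\<Sum>T\<in>Pow (Pow V). \<Sum>a\<in>\<Omega>. of_bool (bad a = T) * h a)"
proof -
  have "(\<Sum>T\<in>Pow (Pow V). \<Sum>a\<in>\<Omega>. of_bool (bad a = T) * h a)
      = (\<Sum>a\<in>\<Omega>. \<Sum>T\<in>Pow (Pow V). of_bool (bad a = T) * h a)"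
    by (rule sum.swap)
  also have "\<dots> = (\<Sum>a\<in>\<Omega>. h a)"
  proof (rule sum.cong[OF refl])
    fix a assume "a \<in> \<Omega>"
    then have "bad a \<in> Pow (Pow V)" by (rule bad_in_Pow)
    then show "(\<Sum>T\<in>Pow (Pow V). of_bool (bad a = T) * h a) = h a"
      using finite_V by (simp add: of_bool_def if_distrib[of "\<lambda>x. x * _"] cong: if_cong)
  qed
  finally show ?thesis by simp
qed

text \<open>The swap with a weight that forces \<open>bad a = T\<close>: given that \<open>T\<close>
  is the current set of bad events, the configuration after the round is uniform on those without a
  bad event away from \<open>T\<close>.\<close>

lemma fiber_resample:
  "(\<Sum>a\<in>\<Omega>. of_bool (bad a = T) * (\<Sum>w\<in>\<Omega>. g (resample (\<Union>(bad a)) w a)))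
     = ways T * (\<Sum>a\<in>\<Omega>. of_bool (far T a = {}) * (g a :: real))"
proof -
  have "of_bool (bad a = T) * (\<Sum>w\<in>\<Omega>. g (resample (\<Union>(bad a)) w a))
     = of_bool (T \<subseteq> bad a) * (\<Sum>w\<in>\<Omega>. of_bool (bad a - T = {}) * g (resample (\<Union>T) w a))" for a
    by (cases "bad a = T") auto
  then show ?thesis
    using swap_identity[of T "\<lambda>S b. of_bool (S = {}) * g b"] by simp
qed

lemma fiber_card:
  "real (card \<Omega>) * (\<Sum>a\<in>\<Omega>. of_bool (bad a = T)) = ways T * good_weight T"
  using fiber_resample[of T "\<lambda>_. 1"]
  by (simp add: good_weight_def sum_distrib_left mult.commute)

text \<open>The swap again, now with one further bad event besides \<open>T\<close>. The factor
  \<open>ways T\<close> is shared with \<open>fiber_card\<close>, so dividing the two realises the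
  ratio in the potential as a count of configurations.\<close>

lemma fiber_single:
  "real (card \<Omega>) * (\<Sum>a\<in>\<Omega>. of_bool (T \<subseteq> bad a \<and> card (bad a - T) = 1) * real (card (\<Union>(bad a - T))))
     = ways T * single_weight T"
  using swap_identity[of T "\<lambda>S b. of_bool (card S = 1) * card (\<Union>S)"]
  by (simp add: single_weight_def sum_distrib_left mult.left_commute of_bool_conj mult.assoc)

lemma good_weight_pos: "good_weight T > 0"
proof -
  obtain a where "a \<in> \<Omega>" "bad a = {}" using good_exists by blast
  then show ?thesis unfolding good_weight_def
    using finite_\<Omega> by (intro sum_pos2[of _ a]) (auto simp: far_def)
qed

section \<open>The balance identity behind the potential\<close>

lemma card_Union_bad:
  assumes "a \<in> \<Omega>" "S \<subseteq> bad a" shows "card (\<Union>S) = (\<Sum>C\<in>S. card C)"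
  using assms bad_disjoint finite_bad_member
  by (intro card_Union_disjoint) (auto simp: pairwise_def disjnt_def, blast+)

lemma single_removal:
  assumes "finite S"
  shows "(\<Sum>T\<in>Pow S. of_bool (card (S - T) = 1) * f T (S - T)) = (\<Sum>i\<in>S. f (S - {i}) {i} :: real)"
proof -
  have "(\<Sum>T\<in>Pow S. of_bool (card (S - T) = 1) * f T (S - T))
      = (\<Sum>T\<in>(\<lambda>i. S - {i}) ` S. f T (S - T))"
  proof (rule sum.mono_neutral_cong_right)
    show "\<forall>T\<in>Pow S - (\<lambda>i. S - {i}) ` S. of_bool (card (S - T) = 1) * f T (S - T) = 0"
    proof clarsimp
      fix T assume T: "T \<subseteq> S" "T \<notin> (\<lambda>i. S - {i}) ` S" "card (S - T) = Suc 0"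
      then obtain i where "S - T = {i}" by (auto simp: card_Suc_eq)
      then have "T = S - {i}" "i \<in> S" using T by auto
      then show "f T (S - T) = 0" using T by blast
    qed
  qed (use assms in \<open>auto simp: Diff_Diff_Int\<close>)
  also have "\<dots> = (\<Sum>i\<in>S. f (S - {i}) {i})"
    by (subst sum.reindex) (auto simp: inj_on_def Diff_Diff_Int Int_absorb1)
  finally show ?thesis .
qed

text \<open>After dropping \<open>i\<close>, all remaining bad sets meet \<open>\<Union>R\<close>
  iff \<open>far R a \<subseteq> {i}\<close>. So with no far set every \<open>i\<close> counts and
  the sum cancels the total size; with exactly one only that one survives; with two or more both
  sides vanish.\<close>

lemma pointwise_balance:
  assumes a: "a \<in> \<Omega>"
  shows "of_bool (far R a = {}) * real (card (\<Union>(bad a)))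
      - (\<Sum>i\<in>bad a. of_bool (\<forall>C\<in>bad a - {i}. C \<inter> \<Union>R \<noteq> {}) * real (card i))
      = - (of_bool (card (far R a) = 1) * real (card (\<Union>(far R a))))"
proof -
  have fin: "finite (bad a)" using finite_bad a by blast
  have sub: "far R a \<subseteq> bad a" by (auto simp: far_def)
  have iff: "(\<forall>C\<in>bad a - {i}. C \<inter> \<Union>R \<noteq> {}) \<longleftrightarrow> far R a \<subseteq> {i}" for i
    by (auto simp: far_def)
  consider "far R a = {}" | j where "far R a = {j}" | "far R a \<noteq> {}" "\<And>i. far R a \<noteq> {i}" by blast
  then show ?thesis
  proof cases
    case 1
    then show ?thesis using card_Union_bad[OF a order_refl] unfolding iff by simp
  next
    case (2 j)
    then have "j \<in> bad a" using sub by auto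
    moreover have "(\<Sum>i\<in>bad a. of_bool (j = i) * real (card i)) = (\<Sum>i\<in>bad a. if i = j then real (card i) else 0)"
      by (rule sum.cong) auto
    ultimately show ?thesis unfolding iff using 2 fin by simp
  next
    case 3
    then have "\<not> far R a \<subseteq> {i}" for i by blast
    moreover have "card (far R a) \<noteq> 1" using 3 by (auto simp: card_1_singleton_iff)
    ultimately show ?thesis unfolding iff using 3 by simp
  qed
qed

text \<open>The quotient disappears by \<open>fiber\<close>: the number of configurations with bad
  set \<open>T\<close>, times the ratio, is the total weight of configurations whose bad set is
  \<open>T\<close> plus one more event. Exchanging the sums then charges each configuration once for
  every event it could drop, which leaves a pointwise identity.\<close>

lemma balance:
  "(\<Sum>a\<in>\<Omega>. of_bool (far R a = {}) * (card (\<Union>(bad a)) - single_weight (bad a) / good_weight (bad a)))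
    = - single_weight R"
proof -
  let ?hit = "\<lambda>T. \<forall>C\<in>T. C \<inter> \<Union>R \<noteq> {}"
  have hit: "far R a = {} \<longleftrightarrow> ?hit (bad a)" for a by (auto simp: far_def)
  have fiber: "(\<Sum>a\<in>\<Omega>. of_bool (bad a = T)) * (single_weight T / good_weight T)
      = (\<Sum>a\<in>\<Omega>. of_bool (T \<subseteq> bad a \<and> card (bad a - T) = 1) * real (card (\<Union>(bad a - T))))" for T
  proof -
    have "real (card \<Omega>) * ((\<Sum>a\<in>\<Omega>. of_bool (bad a = T)) * (single_weight T / good_weight T))
        = ways T * single_weight T"
      using fiber_card[of T] good_weight_pos[of T] by (simp add: field_simps)
    also note fiber_single[of T, symmetric]
    finally show ?thesis using card_\<Omega>_pos by (subst (asm) mult_cancel_left) auto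
  qed
  have "(\<Sum>a\<in>\<Omega>. of_bool (far R a = {}) * (single_weight (bad a) / good_weight (bad a)))
     = (\<Sum>T\<in>Pow (Pow V). of_bool (?hit T) * ((\<Sum>a\<in>\<Omega>. of_bool (bad a = T)) * (single_weight T / good_weight T)))"
    unfolding sum_distrib_left sum_distrib_right
    by (subst sum_bad_eq) (intro sum.cong refl, auto simp: hit of_bool_def)
  also have "\<dots> = (\<Sum>T\<in>Pow (Pow V). \<Sum>a\<in>\<Omega>. of_bool (?hit T) *
      (of_bool (T \<subseteq> bad a \<and> card (bad a - T) = 1) * real (card (\<Union>(bad a - T)))))"
    unfolding fiber sum_distrib_left ..
  also have "\<dots> = (\<Sum>a\<in>\<Omega>. \<Sum>T\<in>Pow (Pow V). of_bool (?hit T) *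
      (of_bool (T \<subseteq> bad a \<and> card (bad a - T) = 1) * real (card (\<Union>(bad a - T)))))"
    by (rule sum.swap)
  also have "\<dots> = (\<Sum>a\<in>\<Omega>. \<Sum>i\<in>bad a. of_bool (?hit (bad a - {i})) * real (card i))"
  proof (rule sum.cong[OF refl])
    fix a assume a: "a \<in> \<Omega>"
    have "(\<Sum>T\<in>Pow (Pow V). of_bool (?hit T) *
        (of_bool (T \<subseteq> bad a \<and> card (bad a - T) = 1) * real (card (\<Union>(bad a - T)))))
      = (\<Sum>T\<in>Pow (bad a). of_bool (card (bad a - T) = 1) * (of_bool (?hit T) * real (card (\<Union>(bad a - T)))))"
      using bad_in_Pow[OF a] finite_V by (intro sum.mono_neutral_cong_right) auto
    also have "\<dots> = (\<Sum>i\<in>bad a. of_bool (?hit (bad a - {i})) * real (card i))"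
      using single_removal[OF finite_bad[OF a], of "\<lambda>T U. of_bool (?hit T) * real (card (\<Union>U))"]
      by simp
    finally show "(\<Sum>T\<in>Pow (Pow V). of_bool (?hit T) *
        (of_bool (T \<subseteq> bad a \<and> card (bad a - T) = 1) * real (card (\<Union>(bad a - T)))))
       = (\<Sum>i\<in>bad a. of_bool (?hit (bad a - {i})) * real (card i))" .
  qed
  finally have "(\<Sum>a\<in>\<Omega>. of_bool (far R a = {}) * (card (\<Union>(bad a)) - single_weight (bad a) / good_weight (bad a)))
    = (\<Sum>a\<in>\<Omega>. of_bool (far R a = {}) * real (card (\<Union>(bad a)))
        - (\<Sum>i\<in>bad a. of_bool (?hit (bad a - {i})) * real (card i)))"
    unfolding right_diff_distrib sum_subtractf by simp
  also have "\<dots> = - single_weight R"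
    unfolding single_weight_def sum_negf[symmetric] by (rule sum.cong[OF refl], rule pointwise_balance)
  finally show ?thesis .
qed

lemma sum_potential_far:
  "(\<Sum>a\<in>\<Omega>. of_bool (far R a = {}) * potential a)
     = single_weight {} / good_weight {} * good_weight R - single_weight R"
proof -
  let ?K = "single_weight {} / good_weight {}"
  have "(\<Sum>a\<in>\<Omega>. of_bool (far R a = {}) * potential a)
    = (\<Sum>a\<in>\<Omega>. ?K * of_bool (far R a = {}) + of_bool (far R a = {})
        * (card (\<Union>(bad a)) - single_weight (bad a) / good_weight (bad a)))"
    by (rule sum.cong) (auto simp: potential_def)
  also have "\<dots> = ?K * good_weight R - single_weight R"
    unfolding sum.distrib sum_distrib_left[symmetric] balance by (simp add: good_weight_def)
  finally show ?thesis .
qed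

text \<open>The drop holds only on average over each fibre of \<open>bad\<close>: for a single
  \<open>a\<close> the values off the bad sets are frozen and influence
  \<open>expected potential a\<close>, whereas \<open>potential a\<close> sees \<open>bad a\<close>
  alone. Hence the weight \<open>c (bad a)\<close>.\<close>

lemma expected_potential:
  "(\<Sum>a\<in>\<Omega>. c (bad a) * expected potential a)
     = (\<Sum>a\<in>\<Omega>. c (bad a) * (potential a - card (\<Union>(bad a))))"
proof -
  let ?N = "real (card \<Omega>)" and ?K = "single_weight {} / good_weight {}"
  have N: "?N > 0" using card_\<Omega>_pos by simp
  have fiber: "?N * (\<Sum>a\<in>\<Omega>. of_bool (bad a = T) * expected potential a)
      = ?N * (\<Sum>a\<in>\<Omega>. of_bool (bad a = T) * (potential a - card (\<Union>(bad a))))" for T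
  proof -
    have "?N * (\<Sum>a\<in>\<Omega>. of_bool (bad a = T) * expected potential a)
       = (\<Sum>a\<in>\<Omega>. of_bool (bad a = T) * (\<Sum>w\<in>\<Omega>. potential (resample (\<Union>(bad a)) w a)))"
      using N by (simp add: expected_def sum_divide_distrib[symmetric])
    also have "\<dots> = ways T * (?K * good_weight T - single_weight T)"
      unfolding fiber_resample sum_potential_far ..
    also have "\<dots> = ways T * good_weight T * (?K - single_weight T / good_weight T)"
      using good_weight_pos[of T] by (simp add: right_diff_distrib)
    also have "\<dots> = ?N * (\<Sum>a\<in>\<Omega>. of_bool (bad a = T)) * (?K - single_weight T / good_weight T)"
      unfolding fiber_card ..
    also have "\<dots> = ?N * (\<Sum>a\<in>\<Omega>. of_bool (bad a = T) * (potential a - card (\<Union>(bad a))))"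
      unfolding mult.assoc sum_distrib_right
      by (rule arg_cong[of _ _ "\<lambda>x. ?N * x"], rule sum.cong) (auto simp: potential_def)
    finally show ?thesis .
  qed
  have "(\<Sum>a\<in>\<Omega>. c (bad a) * g a) = (\<Sum>T\<in>Pow (Pow V). c T * (\<Sum>a\<in>\<Omega>. of_bool (bad a = T) * g a))" for g
    by (subst sum_bad_eq) (auto simp: sum_distrib_left intro!: sum.cong)
  then show ?thesis using fiber N by simp
qed

section \<open>Iterated rounds and the telescoping sum\<close>

lemma sum_expected:
  "(\<Sum>a\<in>\<Omega>. c (bad a) * expected g a) = (\<Sum>a\<in>\<Omega>. push c (bad a) * g a)"
proof -
  have "(\<Sum>a\<in>\<Omega>. c (bad a) * expected g a)
      = (\<Sum>T\<in>Pow (Pow V). c T / card \<Omega> * (\<Sum>a\<in>\<Omega>. of_bool (bad a = T) *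
          (\<Sum>w\<in>\<Omega>. g (resample (\<Union>(bad a)) w a))))"
    by (subst sum_bad_eq) (auto simp: expected_def sum_distrib_left sum_divide_distrib intro!: sum.cong)
  also have "\<dots> = (\<Sum>T\<in>Pow (Pow V). \<Sum>a\<in>\<Omega>. c T / card \<Omega> * (ways T * (of_bool (far T a = {}) * g a)))"
    unfolding fiber_resample by (simp only: sum_distrib_left)
  also have "\<dots> = (\<Sum>a\<in>\<Omega>. \<Sum>T\<in>Pow (Pow V). c T / card \<Omega> * (ways T * (of_bool (far T a = {}) * g a)))"
    by (rule sum.swap)
  also have "\<dots> = (\<Sum>a\<in>\<Omega>. push c (bad a) * g a)"
    unfolding push_def sum_distrib_right sum_divide_distrib
    by (intro sum.cong refl) (auto simp: far_def of_bool_def)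
  finally show ?thesis .
qed

lemma sum_expected_iter:
  "(\<Sum>a\<in>\<Omega>. c (bad a) * (expected ^^ t) g a) = (\<Sum>a\<in>\<Omega>. (push ^^ t) c (bad a) * g a)"
proof (induction t arbitrary: c)
  case (Suc t)
  show ?case using Suc[of "push c"] sum_expected[of c "(expected ^^ t) g"]
    by (simp add: funpow_swap1)
qed simp

lemma ways_nonneg: "ways T \<ge> 0"
  by (simp add: ways_def sum_nonneg)

theorem sum_expected_resampled:
  defines "m \<equiv> \<lambda>t. (\<Sum>a\<in>\<Omega>. (expected ^^ t) (\<lambda>a. card (\<Union>(bad a))) a) / card \<Omega>"
  shows "summable m" and "suminf m \<le> single_weight {} / good_weight {}"
proof -
  let ?K = "single_weight {} / good_weight {}"
  define c where "c t = (push ^^ t) (\<lambda>_. 1 / card \<Omega>)" for t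
  define s where "s t = (\<Sum>a\<in>\<Omega>. c t (bad a) * potential a)" for t
  define L where "L = (\<Sum>a\<in>\<Omega>. \<bar>potential a\<bar>)"
  have L: "L \<ge> 0" by (simp add: L_def sum_nonneg)
  have c_nonneg: "c t T \<ge> 0" for t T
    by (induction t arbitrary: T)
      (auto simp: c_def push_def ways_nonneg intro!: divide_nonneg_nonneg sum_nonneg)
  have m: "m t = (\<Sum>a\<in>\<Omega>. c t (bad a) * card (\<Union>(bad a)))" for t
    using sum_expected_iter[of "\<lambda>_. 1 / card \<Omega>" t "\<lambda>a. card (\<Union>(bad a))"]
    by (simp add: m_def c_def sum_divide_distrib)
  have m_nonneg: "m t \<ge> 0" for t
    unfolding m by (intro sum_nonneg mult_nonneg_nonneg c_nonneg) simp
  have step: "s (Suc t) = s t - m t" for t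
    using sum_expected[of "c t" potential] expected_potential[of "c t"]
    by (simp add: s_def m c_def right_diff_distrib sum_subtractf)
  have partial: "(\<Sum>t<n. m t) = s 0 - s n" for n
    by (induction n) (simp_all add: step)
  \<comment> \<open>Every bad set meets \<open>V\<close>, so with \<open>R = {V}\<close> the
    condition \<open>far R a = {}\<close> is always true and \<open>sum_potential_far\<close>
    evaluates the plain mean of the potential.\<close>
  have far_V: "far {V} a = {}" if "a \<in> \<Omega>" for a
    using bad_subset[OF that] bad_nonempty[OF that] by (fastforce simp: far_def)
  have s0: "s 0 = ?K"
  proof -
    have "single_weight {V} = 0" using far_V by (simp add: single_weight_def)
    moreover have "good_weight {V} = card \<Omega>" using far_V by (simp add: good_weight_def)
    moreover have "(\<Sum>a\<in>\<Omega>. of_bool (far {V} a = {}) * potential a) = (\<Sum>a\<in>\<Omega>. potential a)"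
      using far_V by (intro sum.cong) auto
    ultimately have "(\<Sum>a\<in>\<Omega>. potential a) = ?K * card \<Omega>"
      using sum_potential_far[of "{V}"] by simp
    then show ?thesis using card_\<Omega>_pos by (simp add: s_def c_def sum_divide_distrib[symmetric])
  qed
  \<comment> \<open>The potential vanishes on good configurations, and on all others at least one
    variable is resampled, so a uniform bound \<open>L\<close> on its modulus can be charged to the
    resampled variables.\<close>
  have lower: "- (L * m n) \<le> s n" for n
  proof -
    have "- (L * (c n (bad a) * card (\<Union>(bad a)))) \<le> c n (bad a) * potential a" if a: "a \<in> \<Omega>" for a
    proof (cases "bad a = {}")
      case True
      then show ?thesis by (simp add: potential_def)
    next
      case False
      have "\<bar>potential a\<bar> \<le> L" unfolding L_def using a finite_\<Omega> by (intro member_le_sum) auto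
      moreover have "card (\<Union>(bad a)) \<ge> 1"
      proof -
        have "\<Union>(bad a) \<noteq> {}" using False bad_nonempty[OF a] by blast
        moreover have "finite (\<Union>(bad a))" using finite_bad[OF a] finite_bad_member[OF a] by blast
        ultimately show ?thesis by (simp add: Suc_le_eq card_gt_0_iff)
      qed
      ultimately have "- (L * card (\<Union>(bad a))) \<le> potential a"
        using L mult_left_mono[of 1 "real (card (\<Union>(bad a)))" L] by simp
      then show ?thesis using mult_left_mono[OF _ c_nonneg[of n "bad a"]] by (fastforce simp: mult_ac)
    qed
    then have "(\<Sum>a\<in>\<Omega>. - (L * (c n (bad a) * card (\<Union>(bad a))))) \<le> s n"
      unfolding s_def by (rule sum_mono)
    then show ?thesis unfolding m by (simp add: sum_negf sum_distrib_left)
  qed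
  have m_le: "m n \<le> card V" for n
  proof -
    \<comment> \<open>Total mass is preserved because \<open>expected\<close> fixes the constant
      1.\<close>
    have "(\<Sum>a\<in>\<Omega>. c n (bad a)) = 1"
    proof -
      have "expected (\<lambda>_. 1) = (\<lambda>_. 1)" using card_\<Omega>_pos by (auto simp: expected_def)
      then have "(expected ^^ n) (\<lambda>_. 1) = (\<lambda>_. 1)" by (induction n) simp_all
      then show ?thesis using sum_expected_iter[of "\<lambda>_. 1 / card \<Omega>" n "\<lambda>_. 1"] card_\<Omega>_pos
        by (simp add: c_def)
    qed
    moreover have "c n (bad a) * card (\<Union>(bad a)) \<le> c n (bad a) * card V" if "a \<in> \<Omega>" for a
      using bad_subset[OF that] finite_V c_nonneg
      by (intro mult_left_mono) (auto intro!: card_mono)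
    then have "m n \<le> (\<Sum>a\<in>\<Omega>. c n (bad a) * card V)" unfolding m by (rule sum_mono)
    ultimately show ?thesis by (simp add: sum_distrib_right[symmetric])
  qed
  \<comment> \<open>Used twice: the crude bound \<open>m n \<le> card V\<close> yields summability,
    and summability forces \<open>m n\<close> to 0, which removes the error term in the
    limit.\<close>
  have upper: "(\<Sum>t<n. m t) \<le> ?K + L * m n" for n
    using partial[of n] s0 lower[of n] by simp
  show sm: "summable m"
  proof (rule summableI_nonneg_bounded[where x = "?K + L * card V"])
    show "(\<Sum>t<n. m t) \<le> ?K + L * card V" for n
      using upper[of n] mult_left_mono[OF m_le L, of n] by linarith
  qed (rule m_nonneg)
  have "(\<lambda>n. ?K + L * m n) \<longlonglongrightarrow> ?K + L * 0"
    using summable_LIMSEQ_zero[OF sm] by (intro tendsto_intros)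
  then show "suminf m \<le> ?K"
    using LIMSEQ_le[OF summable_LIMSEQ[OF sm]] upper by fastforce
qed

end

section \<open>The expected number of resampled variables\<close>

text \<open>The recursion peels off the first round instead of the last, matching the decomposition
  of a random stream into its independent head and tail.\<close>

primrec run ::
  "'a set set \<Rightarrow> ('a set set \<Rightarrow> ('a \<times> 'a) set) \<Rightarrow> ('a \<Rightarrow> 'a) \<Rightarrow> ('a \<Rightarrow> 'a) stream \<Rightarrow> nat \<Rightarrow> 'a \<Rightarrow> 'a" where
  "run E orient a \<omega> 0 = a"
| "run E orient a \<omega> (Suc t) = run E orient (resample (Bad E orient a) (shd \<omega>) a) (stl \<omega>) t"

lemma run_last:
  "run E orient a \<omega> (Suc t)
     = resample (Bad E orient (run E orient a \<omega> t)) (\<omega> !! t) (run E orient a \<omega> t)"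
  by (induction t arbitrary: a \<omega>) simp_all

lemma bicycle_popping_run: "bicycle_popping E orient \<omega> t = run E orient (shd \<omega>) (stl \<omega>) t"
proof (induction t)
  case (Suc t)
  show ?case unfolding run_last by (simp add: Suc Let_def resample_def snth.simps(2)[symmetric] del: snth.simps(2))
qed simp

lemma nn_integral_num_resampled_le:
  fixes V :: "'a set" and \<Omega> :: "('a \<Rightarrow> 'a) set"
  assumes inst: "extremal_instance V \<Omega> bad"
    and Bad: "\<And>a. a \<in> \<Omega> \<Longrightarrow> Bad E orient a = \<Union>(bad a)"
    and pmf: "arc_pmf V E = pmf_of_set \<Omega>"
  shows "(\<integral>\<^sup>+ \<omega>. num_resampled E orient \<omega> \<partial>sample_space V E)
     \<le> ennreal (extremal_instance.single_weight \<Omega> bad {} / extremal_instance.good_weight \<Omega> bad {})"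
proof -
  interpret extremal_instance V \<Omega> bad by fact
  let ?M = "measure_pmf (arc_pmf V E)"
  let ?S = "stream_space ?M"
  interpret S: prob_space ?S by (rule prob_space.prob_space_stream_space[OF prob_space_measure_pmf])
  obtain a0 where a0: "a0 \<in> \<Omega>" using good_exists by blast
  have ne: "\<Omega> \<noteq> {}" using a0 by blast
  \<comment> \<open>Samples lie in \<open>\<Omega>\<close> only almost surely. Clamping makes this
    hold everywhere, so inductions over rounds stay inside \<open>\<Omega>\<close>, and
    measurability in the head of the stream reduces to finitely many values.\<close>
  define clamp where "clamp x = (if x \<in> \<Omega> then x else a0)" for x
  have clamp: "clamp x \<in> \<Omega>" for x by (simp add: clamp_def a0)
  have clamp_meas: "clamp \<in> measurable ?M (count_space \<Omega>)" using clamp by simp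
  define b where "b a = real (card (\<Union>(bad a)))" for a
  define X where "X a \<omega> t = ennreal (b (run E orient a (smap clamp \<omega>) t))" for a \<omega> t
  have X_Suc: "X a \<omega> (Suc t) = X (resample (\<Union>(bad a)) (clamp (shd \<omega>)) a) (stl \<omega>) t" if "a \<in> \<Omega>" for a \<omega> t
    by (simp add: X_def Bad[OF that])
  have meas: "(\<lambda>\<omega>. X a \<omega> t) \<in> borel_measurable ?S" if "a \<in> \<Omega>" for a t
    using that
  proof (induction t arbitrary: a)
    case 0
    then show ?case by (simp add: X_def)
  next
    case (Suc t)
    have "(\<lambda>\<omega>. X (resample (\<Union>(bad a)) (clamp (shd \<omega>)) a) (stl \<omega>) t) \<in> borel_measurable ?S"
    proof (rule measurable_compose_countable'[where I = \<Omega> and g = "\<lambda>\<omega>. clamp (shd \<omega>)"])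
      fix x assume x: "x \<in> \<Omega>"
      have "(\<lambda>\<omega>. X (resample (\<Union>(bad a)) x a) \<omega> t) \<in> borel_measurable ?S"
        using Suc.IH[OF resample_in[OF Suc.prems x]] .
      then show "(\<lambda>\<omega>. X (resample (\<Union>(bad a)) x a) (stl \<omega>) t) \<in> borel_measurable ?S"
        by (rule measurable_compose[OF measurable_stl])
    next
      show "(\<lambda>\<omega>. clamp (shd \<omega>)) \<in> measurable ?S (count_space \<Omega>)"
        by (rule measurable_compose[OF measurable_shd clamp_meas])
    qed (simp add: finite_\<Omega> countable_finite)
    then show ?case by (simp add: X_Suc[OF Suc.prems])
  qed
  have integral_M: "(\<integral>\<^sup>+x. ennreal (g (clamp x)) \<partial>?M) = ennreal ((\<Sum>x\<in>\<Omega>. g x) / card \<Omega>)"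
    if "\<And>x. x \<in> \<Omega> \<Longrightarrow> g x \<ge> 0" for g
  proof -
    have "(\<integral>\<^sup>+x. ennreal (g (clamp x)) \<partial>?M) = (\<Sum>x\<in>\<Omega>. ennreal (g (clamp x))) / card \<Omega>"
      unfolding pmf using finite_\<Omega> ne by (rule nn_integral_pmf_of_set[rotated])
    also have "\<dots> = ennreal (\<Sum>x\<in>\<Omega>. g x) / card \<Omega>"
      using that by (simp add: clamp_def cong: sum.cong)
    also have "\<dots> = ennreal ((\<Sum>x\<in>\<Omega>. g x) / card \<Omega>)"
      using that card_\<Omega>_pos
      by (subst divide_ennreal[symmetric]) (auto intro: sum_nonneg simp: ennreal_of_nat_eq_real_of_nat)
    finally show ?thesis .
  qed
  have iter_nonneg: "(expected ^^ t) b a \<ge> 0" for t a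
    by (induction t arbitrary: a) (auto simp: b_def expected_def intro!: divide_nonneg_nonneg sum_nonneg)
  have integral_X: "(\<integral>\<^sup>+\<omega>. X a \<omega> t \<partial>?S) = ennreal ((expected ^^ t) b a)" if "a \<in> \<Omega>" for a t
    using that
  proof (induction t arbitrary: a)
    case 0
    then show ?case by (simp add: X_def S.emeasure_space_1)
  next
    case (Suc t)
    let ?r = "\<lambda>x. resample (\<Union>(bad a)) x a"
    have r: "?r (clamp x) \<in> \<Omega>" for x using Suc.prems clamp by (rule resample_in)
    have "(\<integral>\<^sup>+\<omega>. X a \<omega> (Suc t) \<partial>?S) = (\<integral>\<^sup>+x. (\<integral>\<^sup>+\<omega>. X a (x ## \<omega>) (Suc t) \<partial>?S) \<partial>?M)"
      by (rule prob_space.nn_integral_stream_space[OF prob_space_measure_pmf meas[OF Suc.prems]])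
    also have "\<dots> = (\<integral>\<^sup>+x. ennreal ((expected ^^ t) b (?r (clamp x))) \<partial>?M)"
      using Suc.IH[OF r] by (simp add: X_Suc[OF Suc.prems])
    also have "\<dots> = ennreal ((expected ^^ Suc t) b a)"
      by (subst integral_M) (auto simp: iter_nonneg expected_def)
    finally show ?case .
  qed
  define m where "m t = (\<Sum>a\<in>\<Omega>. (expected ^^ t) b a) / card \<Omega>" for t
  have m_eq: "m = (\<lambda>t. (\<Sum>a\<in>\<Omega>. (expected ^^ t) (\<lambda>a. real (card (\<Union>(bad a)))) a) / card \<Omega>)"
    by (simp add: fun_eq_iff m_def b_def[abs_def])
  note m = sum_expected_resampled[folded m_eq]
  have meas_start: "(\<lambda>\<omega>. X (clamp (shd \<omega>)) (stl \<omega>) t) \<in> borel_measurable ?S" for t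
  proof (rule measurable_compose_countable'[where I = \<Omega> and g = "\<lambda>\<omega>. clamp (shd \<omega>)"])
    show "(\<lambda>\<omega>. clamp (shd \<omega>)) \<in> measurable ?S (count_space \<Omega>)"
      by (rule measurable_compose[OF measurable_shd clamp_meas])
    show "(\<lambda>\<omega>. X x (stl \<omega>) t) \<in> borel_measurable ?S" if "x \<in> \<Omega>" for x
      by (rule measurable_compose[OF measurable_stl meas[OF that]])
  qed (simp add: finite_\<Omega> countable_finite)
  have integral_start: "(\<integral>\<^sup>+\<omega>. X (clamp (shd \<omega>)) (stl \<omega>) t \<partial>?S) = ennreal (m t)" for t
  proof -
    have "(\<integral>\<^sup>+\<omega>. X (clamp (shd \<omega>)) (stl \<omega>) t \<partial>?S)
        = (\<integral>\<^sup>+x. (\<integral>\<^sup>+\<omega>. X (clamp x) \<omega> t \<partial>?S) \<partial>?M)"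
      by (subst prob_space.nn_integral_stream_space[OF prob_space_measure_pmf meas_start]) simp
    also have "\<dots> = ennreal (m t)"
      unfolding m_def integral_X[OF clamp] by (rule integral_M) (rule iter_nonneg)
    finally show ?thesis .
  qed
  have "AE \<omega> in ?S. stream_all (\<lambda>x. x \<in> \<Omega>) \<omega>"
    using finite_\<Omega> ne by (intro prob_space.AE_stream_all[OF prob_space_measure_pmf]) (auto simp: pmf AE_measure_pmf_iff)
  then have "AE \<omega> in ?S. num_resampled E orient \<omega> = (\<Sum>t. X (clamp (shd \<omega>)) (stl \<omega>) t)"
  proof eventually_elim
    case (elim \<omega>)
    then have all: "x \<in> \<Omega>" if "x \<in> sset \<omega>" for x using that by (auto simp: stream.pred_set)
    have run_in: "run E orient (shd \<omega>) (stl \<omega>) t \<in> \<Omega>" for t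
    proof (induction t)
      case 0
      then show ?case using all[OF shd_sset] by simp
    next
      case (Suc t)
      have "stl \<omega> !! t \<in> \<Omega>" using all snth_sset[of \<omega> "Suc t"] by simp
      with Suc show ?case unfolding run_last by (rule resample_in)
    qed
    have "smap clamp \<omega> = \<omega>" using all by (intro stream.map_ident_strong) (auto simp: clamp_def)
    then have "clamp (shd \<omega>) = shd \<omega>" "smap clamp (stl \<omega>) = stl \<omega>"
      by (metis stream.map_sel(1), metis stream.map_sel(2))
    then have "of_nat (card (Bad E orient (bicycle_popping E orient \<omega> t))) = X (clamp (shd \<omega>)) (stl \<omega>) t" for t
      using Bad[OF run_in[of t]]
      by (simp add: X_def b_def bicycle_popping_run ennreal_of_nat_eq_real_of_nat)
    then show ?case by (simp add: num_resampled_def)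
  qed
  then have "(\<integral>\<^sup>+ \<omega>. num_resampled E orient \<omega> \<partial>sample_space V E)
      = (\<integral>\<^sup>+ \<omega>. (\<Sum>t. X (clamp (shd \<omega>)) (stl \<omega>) t) \<partial>?S)"
    unfolding sample_space_def by (rule nn_integral_cong_AE)
  also have "\<dots> = (\<Sum>t. ennreal (m t))"
    by (simp add: nn_integral_suminf[OF meas_start] integral_start)
  also have "\<dots> = ennreal (suminf m)"
    by (rule suminf_ennreal2[OF _ m(1)]) (simp add: m_def iter_nonneg sum_nonneg)
  also have "\<dots> \<le> ennreal (single_weight {} / good_weight {})"
    using m(2) by (rule ennreal_leI)
  finally show ?thesis .
qed

section \<open>Configurations and their cycles\<close>

definition arcs :: "('a \<Rightarrow> 'a) \<Rightarrow> 'a set \<Rightarrow> ('a \<times> 'a) set" where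
  "arcs a D = (\<lambda>u. (u, a u)) ` D"

text \<open>The two vertices of a two-cycle yield the same edge, so the size of this set detects the
  loss of an edge.\<close>

definition links :: "('a \<Rightarrow> 'a) \<Rightarrow> 'a set \<Rightarrow> 'a set set" where
  "links a D = (\<lambda>u. {u, a u}) ` D"

lemma arcs_cong: "(\<And>u. u \<in> D \<Longrightarrow> a u = b u) \<Longrightarrow> arcs a D = arcs b D"
  by (auto simp: arcs_def)

lemma links_cong: "(\<And>u. u \<in> D \<Longrightarrow> a u = b u) \<Longrightarrow> links a D = links b D"
  by (auto simp: links_def)

lemma arcs_eqD: "arcs a D = arcs b D \<Longrightarrow> u \<in> D \<Longrightarrow> a u = b u"
  by (auto simp: arcs_def set_eq_iff image_iff)

text \<open>Under \<open>a\<close> the edge \<open>{u, c u}\<close> must be the arc of one of its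
  ends; it is not the arc of \<open>u\<close>, so it is the arc of \<open>c u\<close>.\<close>

lemma links_eqD:
  assumes "links a X = links c X" "u \<in> X" "c u \<noteq> a u"
  shows "c u \<in> X" "a (c u) = u"
proof -
  have "{u, c u} \<in> links a X" using assms by (auto simp: links_def)
  then obtain t where "t \<in> X" "{u, c u} = {t, a t}" by (auto simp: links_def)
  then show "c u \<in> X" "a (c u) = u" using assms(3) by (auto simp: doubleton_eq_iff)
qed

lemma Union_links: "a ` D \<subseteq> D \<Longrightarrow> \<Union>(links a D) = D"
  by (auto simp: links_def)

lemma cyclic_on_bij_betw:
  assumes "cyclic_on a D" shows "bij_betw a D D"
proof -
  have "v \<in> a ` D" if v: "v \<in> D" for v
  proof -
    have "v \<in> orbit a v" using orbit_cyclic_eq3[OF assms v] v by simp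
    then obtain n where n: "v = (a ^^ n) v" "0 < n" by (auto simp: orbit_altdef)
    then obtain k where "n = Suc k" by (cases n) auto
    with n(1) have "v = a ((a ^^ k) v)" by simp
    then show ?thesis using cyclic_on_funpow_in[OF assms v, of k] by (rule image_eqI)
  qed
  then have "a ` D = D" using cyclic_on_inI[OF assms] by blast
  then show ?thesis
    using finite_cyclic_on[OF assms] by (simp add: bij_betw_def eq_card_imp_inj_on)
qed

lemma two_cycle_iff:
  "cyclic_on a D \<and> card D = 2 \<and> s \<in> D \<longleftrightarrow> D = {s, a s} \<and> a s \<noteq> s \<and> a (a s) = s"
proof
  assume "cyclic_on a D \<and> card D = 2 \<and> s \<in> D"
  then have D: "cyclic_on a D" "card D = 2" "s \<in> D" by auto
  have no_fix: "a t \<noteq> t" if "t \<in> D" for t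
  proof
    assume "a t = t"
    then have "D = {t}" using orbit_cyclic_eq3[OF D(1) that] orbit_eq_singleton_iff by metis
    then show False using D(2) by simp
  qed
  have "a s \<in> D" "a (a s) \<in> D" using cyclic_on_inI[OF D(1)] D(3) by auto
  moreover have "D = {s, a s}"
    using D \<open>a s \<in> D\<close> no_fix[OF D(3)] by (auto simp: card_2_iff doubleton_eq_iff)
  ultimately show "D = {s, a s} \<and> a s \<noteq> s \<and> a (a s) = s"
    using no_fix[OF D(3)] no_fix[of "a s"] by blast
next
  assume s: "D = {s, a s} \<and> a s \<noteq> s \<and> a (a s) = s"
  have "(a ^^ 2) s = s" using s by (simp add: numeral_2_eq_2)
  then have "orbit a s = {(a ^^ m) s | m. m < 2}" by (rule orbit_altdef_bounded) simp
  also have "\<dots> = {s, a s}" by (auto simp: less_2_cases_iff intro: exI[of _ 0] exI[of _ 1])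
  finally have "orbit a s = {s, a s}" .
  then show "cyclic_on a D \<and> card D = 2 \<and> s \<in> D" using s by (auto intro: cyclic_on_singleI)
qed

lemma cyclic_on_reverse:
  assumes D: "cyclic_on a D" and b: "\<And>u. u \<in> D \<Longrightarrow> b u \<in> D" "\<And>u. u \<in> D \<Longrightarrow> b (a u) = u"
  shows "cyclic_on b D"
proof -
  obtain s where s: "s \<in> D" using D by (auto simp: cyclic_on_def)
  have "t \<in> orbit b s" if t: "t \<in> D" for t
  proof -
    have "s \<in> orbit a t" using orbit_cyclic_eq3[OF D t] s by simp
    then obtain n where n: "s = (a ^^ n) t" "0 < n" by (auto simp: orbit_altdef)
    have "(b ^^ n) ((a ^^ n) t) = t"
    proof (induction n)
      case (Suc n)
      have "(b ^^ Suc n) ((a ^^ Suc n) t) = (b ^^ n) (b (a ((a ^^ n) t)))"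
        by (simp add: funpow_swap1)
      then show ?case using Suc b(2)[OF cyclic_on_funpow_in[OF D t, of n]] by simp
    qed simp
    then show ?thesis unfolding orbit_altdef n(1)[symmetric] using n(2) by force
  qed
  moreover have "orbit b s \<subseteq> D"
  proof
    fix t assume "t \<in> orbit b s"
    then show "t \<in> D" by induction (auto simp: s b(1))
  qed
  ultimately show ?thesis using s by (intro cyclic_on_singleI[of s]) auto
qed

text \<open>Disagreement propagates along \<open>c\<close>: if \<open>c u \<noteq> a u\<close> then
  \<open>a (c u) = u\<close>, while \<open>c (c u) \<noteq> u\<close> because the length is not 2.
  Hence the maps disagree on the whole orbit or nowhere, and disagreement everywhere means that
  \<open>a\<close> inverts \<open>c\<close>.\<close>

lemma cyclic_on_same_links:
  assumes a: "cyclic_on a D" and c: "cyclic_on c D'" and links: "links a D = links c D'"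
    and card: "card D \<noteq> 2"
  shows "D = D'" and "(\<forall>u\<in>D. c u = a u) \<or> (\<forall>u\<in>D. a (c u) = u)"
proof -
  show D: "D = D'"
    using Union_links[of a D] Union_links[of c D'] links cyclic_on_inI[OF a] cyclic_on_inI[OF c]
    by (simp add: image_subset_iff)
  have closed: "c u \<in> D \<and> c (c u) \<noteq> a (c u) \<and> a (c u) = u" if u: "u \<in> D" "c u \<noteq> a u" for u
  proof -
    have au: "c u \<in> D" "a (c u) = u" using links_eqD[of a D c u] links D u by auto
    have "c (c u) \<noteq> u"
    proof
      assume "c (c u) = u"
      moreover have "c u \<noteq> u" using au u by auto
      moreover have "D = orbit c u" using orbit_cyclic_eq3[OF c, of u] D u by simp
      ultimately have "card D = 2"
        using two_cycle_iff[of c "{u, c u}" u] orbit_cyclic_eq3[of c "{u, c u}" u] by simp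
      then show False using card by simp
    qed
    then show ?thesis using au by auto
  qed
  show "(\<forall>u\<in>D. c u = a u) \<or> (\<forall>u\<in>D. a (c u) = u)"
  proof (cases "\<forall>u\<in>D. c u = a u")
    case False
    then obtain s where s: "s \<in> D" "c s \<noteq> a s" by blast
    have "t \<in> D \<and> c t \<noteq> a t" if "t \<in> orbit c s" for t
      using that
    proof induction
      case base
      show ?case using closed[OF s] by blast
    next
      case (step t)
      then show ?case using closed[of t] by blast
    qed
    moreover have "orbit c s = D" using orbit_cyclic_eq3[OF c] D s by blast
    ultimately have "\<forall>u\<in>D. c u \<noteq> a u" by blast
    then show ?thesis using closed by auto
  qed auto
qed

section \<open>Vertex lists versus cyclic maps\<close>

lemma cycle_arcs_arcs:
  assumes "distinct xs" "xs \<noteq> []"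
  obtains c where "cyclic_on c (set xs)" "cycle_arcs xs = arcs c (set xs)"
proof -
  let ?n = "length xs"
  define c where "c = (\<lambda>u. the (map_of (zip xs (rotate1 xs)) u))"
  have c: "c (xs ! i) = xs ! (Suc i mod ?n)" if "i < ?n" for i
    using map_of_zip_nth[of xs "rotate1 xs" i] assms that by (simp add: c_def nth_rotate1)
  have "rotate1 xs = map c xs"
    using c by (intro nth_equalityI) (simp_all add: nth_rotate1)
  then have "cycle_arcs xs = arcs c (set xs)"
    by (auto simp: cycle_arcs_def arcs_def zip_map2 zip_same_conv_map)
  moreover have "cyclic_on c (set xs)"
  proof (rule cyclic_on_singleI)
    show "xs ! 0 \<in> set xs" using assms by simp
    have iter: "(c ^^ k) (xs ! 0) = xs ! (k mod ?n)" for k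
    proof (induction k)
      case (Suc k)
      then show ?case using c[of "k mod ?n"] assms by (simp add: mod_Suc_eq)
    qed (use assms in simp)
    show "set xs = orbit c (xs ! 0)"
    proof (intro equalityI subsetI)
      fix x assume "x \<in> set xs"
      then obtain i where "i < ?n" "x = xs ! i" by (auto simp: in_set_conv_nth)
      \<comment> \<open>A full extra turn is added since \<open>orbit\<close> asks for at least one
        application of the map.\<close>
      then have "x = (c ^^ (i + ?n)) (xs ! 0)" "0 < i + ?n" unfolding iter by auto
      then show "x \<in> orbit c (xs ! 0)" unfolding orbit_altdef by blast
    next
      fix x assume "x \<in> orbit c (xs ! 0)"
      then show "x \<in> set xs" using assms by (auto simp: orbit_altdef iter)
    qed
  qed
  ultimately show ?thesis using that by blast
qed

lemma arcs_cycle_arcs: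
  assumes D: "cyclic_on a D"
  obtains xs where "distinct xs" "set xs = D" "cycle_arcs xs = arcs a D"
proof -
  obtain s where s: "s \<in> D" using D by (auto simp: cyclic_on_def)
  have orb: "orbit a s = D" using orbit_cyclic_eq3[OF D s] .
  then have self: "s \<in> orbit a s" using s by simp
  define n where "n = funpow_dist1 a s s"
  define xs where "xs = map (\<lambda>k. (a ^^ k) s) [0..<n]"
  have "inj_on (\<lambda>k. (a ^^ k) s) {0..<n}" unfolding n_def by (rule inj_on_funpow_dist1[OF self])
  then have "distinct xs" by (simp add: xs_def distinct_map)
  moreover have "D = (\<lambda>k. (a ^^ k) s) ` {0..<n}"
    using orbit_conv_funpow_dist1[OF self] unfolding orb n_def .
  then have set: "set xs = D" by (simp add: xs_def)
  moreover have "rotate1 xs = map a xs"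
  proof (rule nth_equalityI)
    fix i assume "i < length (rotate1 xs)"
    then have i: "i < n" by (simp add: xs_def)
    have "(a ^^ n) s = s" using funpow_dist1_prop[OF self] by (simp add: n_def)
    then show "rotate1 xs ! i = map a xs ! i"
      using i by (cases "Suc i = n") (auto simp: nth_rotate1 xs_def)
  qed simp
  then have "cycle_arcs xs = arcs a D"
    unfolding set[symmetric] by (simp add: cycle_arcs_def arcs_def zip_map2 zip_same_conv_map)
  ultimately show ?thesis using that by blast
qed

lemma cycle_edges_links: "cycle_arcs xs = arcs a D \<Longrightarrow> cycle_edges xs = links a D"
  by (simp add: cycle_edges_def arcs_def links_def image_image)

section \<open>Bicycle-popping as an extremal instance\<close>

locale bicycle_graph =
  fixes V :: "'a set" and E :: "'a set set"
    and orient :: "'a set set \<Rightarrow> ('a \<times> 'a) set"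
  assumes simple: "simple_graph V E" and connected: "connected_graph V E"
    and card_E: "card E \<ge> card V" and orientation: "cycle_orientation E orient"
begin

definition configs :: "('a \<Rightarrow> 'a) set" where
  "configs = PiE_dflt V undefined (neighbours E)"

text \<open>For fixed \<open>a\<close>, a directed cycle formed by its arcs is determined by its
  vertex set, so events are recorded as vertex sets; those of size 2 are the edge events. All of
  them are orbits of the same map, which is why they are disjoint.\<close>

definition bad :: "('a \<Rightarrow> 'a) \<Rightarrow> 'a set set" where
  "bad a = {D. D \<subseteq> V \<and> cyclic_on a D \<and> (card D = 2 \<or> orient (links a D) = arcs a D)}"

lemma finite_V: "finite V"
  using simple by (simp add: simple_graph_def)

lemma edgeD: assumes "{u, v} \<in> E" shows "u \<in> V" "v \<in> V" "u \<noteq> v"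
proof -
  have "{u, v} \<subseteq> V" "card {u, v} = 2" using simple assms by (auto simp: simple_graph_def)
  then show "u \<in> V" "v \<in> V" "u \<noteq> v" by (auto simp: card_insert_if split: if_splits)
qed

lemma configs_iff: "a \<in> configs \<longleftrightarrow> (\<forall>v\<in>V. {v, a v} \<in> E) \<and> (\<forall>v. v \<notin> V \<longrightarrow> a v = undefined)"
  by (auto simp: configs_def PiE_dflt_def neighbours_def)

lemma configD:
  assumes "a \<in> configs" "v \<in> V" shows "{v, a v} \<in> E" "a v \<in> V" "a v \<noteq> v"
proof -
  show e: "{v, a v} \<in> E" using assms unfolding configs_iff by blast
  show "a v \<in> V" using edgeD(2)[OF e] .
  show "a v \<noteq> v" using edgeD(3)[OF e] by simp
qed

lemma finite_neighbours: "finite (neighbours E v)"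
proof (rule finite_subset[OF _ finite_V])
  show "neighbours E v \<subseteq> V" unfolding neighbours_def using edgeD(2) by blast
qed

lemma E_nonempty: "E \<noteq> {}"
  using card_E finite_V connected by (auto simp: connected_graph_def)

text \<open>An edge exists and has two ends, so some vertex differs from \<open>v\<close>; a path to
  it starts with an edge at \<open>v\<close>.\<close>

lemma neighbours_nonempty:
  assumes "v \<in> V" shows "neighbours E v \<noteq> {}"
proof -
  obtain e where e: "e \<in> E" using E_nonempty by blast
  then have "e \<subseteq> V" "card e = 2" using simple by (auto simp: simple_graph_def)
  then obtain u where u: "u \<in> V" "u \<noteq> v" by (auto simp: card_2_iff)
  have "(v, u) \<in> {(x, y). {x, y} \<in> E}\<^sup>*"
    using connected u assms by (auto simp: connected_graph_def)
  then show ?thesis using u(2) by (cases rule: converse_rtranclE) (auto simp: neighbours_def)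
qed

lemma finite_configs: "finite configs"
  unfolding configs_def using finite_V finite_neighbours by (rule finite_PiE_dflt)

lemma configs_nonempty: "configs \<noteq> {}"
  unfolding configs_def using neighbours_nonempty by (simp add: PiE_dflt_empty_iff)

lemma arc_pmf_configs: "arc_pmf V E = pmf_of_set configs"
  unfolding arc_pmf_def configs_def
  using finite_V finite_neighbours neighbours_nonempty by (intro Pi_pmf_of_set) auto

lemma resample_in_configs: "a \<in> configs \<Longrightarrow> w \<in> configs \<Longrightarrow> resample B w a \<in> configs"
  by (auto simp: configs_iff resample_def)

lemma bad_cong:
  assumes "D \<in> bad a" "\<And>v. v \<in> D \<Longrightarrow> a v = b v" shows "D \<in> bad b"
proof -
  have "cyclic_on a D = cyclic_on b D" using assms(2) by (rule cyclic_cong)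
  moreover have "links a D = links b D" using assms(2) by (rule links_cong)
  moreover have "arcs a D = arcs b D" using assms(2) by (rule arcs_cong)
  ultimately show ?thesis using assms(1) by (simp add: bad_def)
qed

lemma bad_disjoint:
  assumes "C \<in> bad a" "D \<in> bad a" "C \<inter> D \<noteq> {}" shows "C = D"
proof -
  obtain v where "v \<in> C" "v \<in> D" using assms(3) by blast
  then have "orbit a v = C" "orbit a v = D"
    using assms orbit_cyclic_eq3[of a C v] orbit_cyclic_eq3[of a D v] by (auto simp: bad_def)
  then show ?thesis by simp
qed

lemma bad_nonempty: "D \<in> bad a \<Longrightarrow> D \<noteq> {}"
  by (auto simp: bad_def cyclic_on_def)

lemma finite_bad: "finite (bad a)"
  using finite_V by (intro finite_subset[of "bad a" "Pow V"]) (auto simp: bad_def)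

lemma card_cyclic:
  assumes "a \<in> configs" "D \<subseteq> V" "cyclic_on a D" shows "card D \<ge> 2"
proof -
  obtain s where s: "s \<in> D" using assms(3) by (auto simp: cyclic_on_def)
  then have "{s, a s} \<subseteq> D" "a s \<noteq> s"
    using cyclic_on_inI[OF assms(3)] configD[OF assms(1)] assms(2) by auto
  then show ?thesis using card_mono[OF finite_cyclic_on[OF assms(3)], of "{s, a s}"] by simp
qed

lemma two_cycle_bad:
  assumes a: "a \<in> configs" and x: "x \<in> V" "a (a x) = x" shows "{x, a x} \<in> bad a"
proof -
  have "cyclic_on a {x, a x} \<and> card {x, a x} = 2 \<and> x \<in> {x, a x}"
    unfolding two_cycle_iff using configD[OF a x(1)] x(2) by simp
  then show ?thesis using configD[OF a x(1)] x(1) unfolding bad_def by blast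
qed

lemma links_in_cycles:
  assumes a: "a \<in> configs" and D: "D \<subseteq> V" "cyclic_on a D" "card D \<noteq> 2"
  shows "links a D \<in> cycles E"
proof -
  obtain xs where xs: "distinct xs" "set xs = D" "cycle_arcs xs = arcs a D"
    by (rule arcs_cycle_arcs[OF D(2)])
  have "length xs = card D" using distinct_card[OF xs(1)] xs(2) by simp
  then have "length xs \<ge> 3" using card_cyclic[OF a D(1,2)] D(3) by linarith
  moreover have "cycle_edges xs = links a D" by (rule cycle_edges_links[OF xs(3)])
  moreover have "links a D \<subseteq> E" using configD(1)[OF a] D(1) by (auto simp: links_def)
  ultimately show ?thesis using xs(1) unfolding cycles_def cycle_walk_def by blast
qed

lemma orient_obtain:
  assumes "C \<in> cycles E"
  obtains c D where "cyclic_on c D" "links c D = C" "orient C = arcs c D" "C \<subseteq> E"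
proof -
  obtain ys where ys: "cycle_walk E ys" "cycle_edges ys = C" "orient C = cycle_arcs ys"
    using orientation assms unfolding cycle_orientation_def by blast
  have "distinct ys" "ys \<noteq> []" "C \<subseteq> E" using ys by (auto simp: cycle_walk_def)
  then obtain c where c: "cyclic_on c (set ys)" "cycle_arcs ys = arcs c (set ys)"
    using cycle_arcs_arcs by metis
  show ?thesis using that[OF c(1)] cycle_edges_links[OF c(2)] ys c(2) \<open>C \<subseteq> E\<close> by simp
qed

text \<open>By \<open>cyclic_on_same_links\<close> the orientation fixed for the edge set runs
  either with \<open>a\<close> or against it. The second case supplies the opposite map
  \<open>c\<close>, so that any configuration following \<open>c\<close> on \<open>D\<close> has
  \<open>D\<close> bad.\<close>

lemma orient_cases:
  assumes a: "a \<in> configs" and D: "D \<subseteq> V" "cyclic_on a D" "card D \<noteq> 2"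
  obtains "D \<in> bad a"
  | c where "cyclic_on c D" "\<And>u. u \<in> D \<Longrightarrow> a (c u) = u" "links c D = links a D"
      "orient (links a D) = arcs c D"
proof -
  obtain c D' where c: "cyclic_on c D'" "links c D' = links a D" "orient (links a D) = arcs c D'"
    by (rule orient_obtain[OF links_in_cycles[OF a D]])
  note same = cyclic_on_same_links[OF D(2) c(1) c(2)[symmetric] D(3)]
  from same(2) show ?thesis
  proof
    assume "\<forall>u\<in>D. c u = a u"
    then have "arcs c D = arcs a D" by (intro arcs_cong) simp
    then have "D \<in> bad a" using D(1,2) same(1) c(3) by (simp add: bad_def)
    then show ?thesis by (rule that(1))
  next
    assume "\<forall>u\<in>D. a (c u) = u"
    then show ?thesis using that(2)[of c] c unfolding same(1)[symmetric] by blast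
  qed
qed

lemma Bad_eq:
  assumes a: "a \<in> configs" shows "Bad E orient a = \<Union>(bad a)"
proof (intro equalityI subsetI)
  fix v assume "v \<in> Bad E orient a"
  then consider e where "e \<in> E" "edge_event a e" "v \<in> e"
    | C where "C \<in> cycles E" "cycle_event orient a C" "v \<in> \<Union>C"
    by (auto simp: Bad_def)
  then show "v \<in> \<Union>(bad a)"
  proof cases
    case (1 e)
    then obtain u w where e: "e = {u, w}" "a u = w" "a w = u" by (auto simp: edge_event_def)
    then have "e \<in> bad a" using two_cycle_bad[OF a, of u] edgeD[of u w] 1 by auto
    then show ?thesis using 1 by blast
  next
    case (2 C)
    obtain c D where c: "cyclic_on c D" "links c D = C" "orient C = arcs c D" "C \<subseteq> E"
      by (rule orient_obtain[OF 2(1)])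
    have eq: "c u = a u" if "u \<in> D" for u
      using 2(2) that c(3) by (auto simp: cycle_event_def arcs_def)
    have cyc: "cyclic_on a D" using c(1) cyclic_cong[of D c a] eq by blast
    have C: "links a D = C" "arcs a D = arcs c D"
      using links_cong[of D c a] arcs_cong[of D c a] eq c(2) by blast+
    have Un: "\<Union>C = D" unfolding C(1)[symmetric] using cyclic_on_inI[OF cyc] by (intro Union_links) auto
    have "D \<subseteq> V" unfolding Un[symmetric] using c(4) simple by (auto simp: simple_graph_def)
    then have "D \<in> bad a" using cyc c(3) C by (simp add: bad_def)
    then show ?thesis using 2(3) Un by blast
  qed
next
  fix v assume "v \<in> \<Union>(bad a)"
  then obtain D where D: "D \<in> bad a" "v \<in> D" by blast
  then have DV: "D \<subseteq> V" "cyclic_on a D" by (auto simp: bad_def)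
  show "v \<in> Bad E orient a"
  proof (cases "card D = 2")
    case True
    then have v: "D = {v, a v}" "a (a v) = v" using two_cycle_iff[of a D v] D DV by auto
    then have "D \<in> E" "edge_event a D" using configD[OF a, of v] DV by (auto simp: edge_event_def)
    then show ?thesis using D by (auto simp: Bad_def)
  next
    case False
    then have orient: "orient (links a D) = arcs a D" using D by (auto simp: bad_def)
    have "links a D \<in> cycles E" by (rule links_in_cycles[OF a DV False])
    moreover have "cycle_event orient a (links a D)"
      using orient by (auto simp: cycle_event_def arcs_def)
    moreover have "v \<in> \<Union>(links a D)" using D by (auto simp: links_def)
    ultimately show ?thesis by (auto simp: Bad_def)
  qed
qed

section \<open>Reversing a cycle\<close>

definition reverse :: "('a \<Rightarrow> 'a) \<Rightarrow> 'a set \<Rightarrow> 'a \<Rightarrow> 'a" where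
  "reverse a D = (\<lambda>u. if u \<in> D then inv_into D a u else a u)"

lemma reverse:
  assumes "cyclic_on a D" "u \<in> D"
  shows "reverse a D u \<in> D" "a (reverse a D u) = u" "reverse a D (a u) = u"
proof -
  note bij = cyclic_on_bij_betw[OF assms(1)]
  then show "reverse a D u \<in> D" "a (reverse a D u) = u"
    using assms(2) by (auto simp: reverse_def bij_betw_def inv_into_into f_inv_into_f)
  show "reverse a D (a u) = u"
    using bij assms(2) cyclic_on_inI[OF assms] by (simp add: reverse_def bij_betw_def)
qed

lemma cyclic_on_reverse_self: "cyclic_on a D \<Longrightarrow> cyclic_on (reverse a D) D"
  using cyclic_on_reverse reverse by metis

lemma reverse_in_configs:
  assumes "a \<in> configs" "D \<subseteq> V" "cyclic_on a D" shows "reverse a D \<in> configs"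
proof -
  have "{v, reverse a D v} \<in> E" if "v \<in> V" for v
  proof (cases "v \<in> D")
    case True
    then show ?thesis
      using reverse[OF assms(3) True] configD(1)[OF assms(1), of "reverse a D v"] assms(2)
      by (auto simp: insert_commute)
  next
    case False
    then show ?thesis using configD(1)[OF assms(1) that] by (simp add: reverse_def)
  qed
  then show ?thesis using assms by (auto simp: configs_iff reverse_def)
qed

lemma links_reverse:
  assumes "cyclic_on a D" "D \<subseteq> X" shows "links (reverse a D) X = links a X"
proof (intro equalityI subsetI)
  fix e assume "e \<in> links (reverse a D) X"
  then obtain u where u: "u \<in> X" "e = {u, reverse a D u}" by (auto simp: links_def)
  show "e \<in> links a X"
  proof (cases "u \<in> D")
    case True
    then have "e = {reverse a D u, a (reverse a D u)}" "reverse a D u \<in> X"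
      using reverse[OF assms(1) True] u assms(2) by auto
    then show ?thesis by (auto simp: links_def)
  next
    case False
    then show ?thesis using u by (auto simp: links_def reverse_def)
  qed
next
  fix e assume "e \<in> links a X"
  then obtain u where u: "u \<in> X" "e = {u, a u}" by (auto simp: links_def)
  show "e \<in> links (reverse a D) X"
  proof (cases "u \<in> D")
    case True
    then have "e = {a u, reverse a D (a u)}" "a u \<in> X"
      using reverse[OF assms(1) True] u assms(2) cyclic_on_inI[OF assms(1) True] by auto
    then show ?thesis unfolding links_def by blast
  next
    case False
    then have "e = {u, reverse a D u}" using u by (simp add: reverse_def)
    then show ?thesis using u unfolding links_def by blast
  qed
qed

lemma reverse_eqD:
  assumes "cyclic_on a D" "cyclic_on b D" "reverse a D = reverse b D" shows "a = b"
proof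
  fix u
  show "a u = b u"
  proof (cases "u \<in> D")
    case True
    have "a u = b (reverse b D (a u))" using reverse(2)[OF assms(2)] cyclic_on_inI[OF assms(1) True] by simp
    also have "\<dots> = b u" using reverse(3)[OF assms(1) True] assms(3) by simp
    finally show ?thesis .
  next
    case False
    then show ?thesis using fun_cong[OF assms(3), of u] by (simp add: reverse_def)
  qed
qed

text \<open>A bad set of the reversed configuration that meets \<open>D\<close> is the orbit
  \<open>D\<close> itself. Were it bad in both directions, both would equal the one chosen
  orientation, so \<open>a\<close> would be its own inverse on \<open>D\<close> and \<open>D\<close>
  a two-cycle.\<close>

lemma bad_reverse:
  assumes a: "a \<in> configs" and D: "D \<in> bad a" "card D \<noteq> 2"
  shows "bad (reverse a D) \<subseteq> bad a - {D}"
proof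
  let ?b = "reverse a D"
  have cyc: "D \<subseteq> V" "cyclic_on a D" using D by (auto simp: bad_def)
  fix C assume C: "C \<in> bad ?b"
  show "C \<in> bad a - {D}"
  proof (cases "C \<inter> D = {}")
    case True
    then have "?b v = a v" if "v \<in> C" for v using that by (auto simp: reverse_def)
    then have "C \<in> bad a" by (rule bad_cong[OF C])
    then show ?thesis using True bad_nonempty[OF C] by auto
  next
    case False
    then obtain v where v: "v \<in> C" "v \<in> D" by blast
    have "C = D" using C v orbit_cyclic_eq3[of ?b C v] orbit_cyclic_eq3[OF cyclic_on_reverse_self[OF cyc(2)] v(2)]
      by (auto simp: bad_def)
    then have "orient (links ?b D) = arcs ?b D" "orient (links a D) = arcs a D"
      using C D by (auto simp: bad_def)
    then have "a v = ?b v" using links_reverse[OF cyc(2) order_refl] arcs_eqD[of a D ?b v] v by simp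
    then have "a (a v) = v" using reverse(2)[OF cyc(2) v(2)] by simp
    then have "cyclic_on a {v, a v} \<and> card {v, a v} = 2"
      using two_cycle_iff[of a "{v, a v}" v] configD[OF a, of v] cyc v by auto
    then have "card D = 2"
      using orbit_cyclic_eq3[of a "{v, a v}" v] orbit_cyclic_eq3[OF cyc(2) v(2)] by simp
    then show ?thesis using D by simp
  qed
qed

section \<open>Moving and removing a two-cycle\<close>

lemma links_redirect:
  assumes a: "a \<in> configs" and x: "x \<in> V" "a (a x) = x"
  shows "links (a(x := y)) V = insert {x, y} (links a V)"
proof (intro equalityI subsetI)
  fix e assume "e \<in> insert {x, y} (links a V)"
  then consider "e = {x, y}" | "e = {x, a x}" | t where "t \<in> V" "t \<noteq> x" "e = {t, a t}"
    by (auto simp: links_def)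
  then show "e \<in> links (a(x := y)) V"
  proof cases
    case 1
    then show ?thesis using x by (auto simp: links_def)
  next
    case 2
    \<comment> \<open>The edge \<open>{x, a x}\<close> survives the redirection as the arc of
      \<open>a x\<close>.\<close>
    then have "e = {a x, (a(x := y)) (a x)}" using x configD[OF a x(1)] by auto
    then show ?thesis using configD[OF a x(1)] unfolding links_def by blast
  next
    case (3 t)
    then have "e = {t, (a(x := y)) t}" by simp
    then show ?thesis using 3 unfolding links_def by blast
  qed
qed (auto simp: links_def)

lemma redirect_in_configs:
  assumes "a \<in> configs" "{x, y} \<in> E" shows "a(x := y) \<in> configs"
  using assms edgeD[of x y] by (auto simp: configs_iff)

lemma bad_redirect:
  assumes "C \<in> bad (a(x := y))" "x \<notin> C" shows "C \<in> bad a"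
  using assms(1) by (rule bad_cong) (use assms(2) in auto)

text \<open>The arc of \<open>x\<close> is free to move. Unless \<open>y = a x\<close>, the used
  edge \<open>{x, y}\<close> is the arc of \<open>y\<close>, so pointing \<open>x\<close> at
  \<open>y\<close> shifts the two-cycle to \<open>{x, y}\<close> and keeps the edge set. Every other
  bad set of the new configuration avoids \<open>x\<close>, hence was bad before.\<close>

lemma move_two_cycle_step:
  assumes a: "a \<in> configs" and x: "x \<in> V" "a (a x) = x" and y: "{x, y} \<in> links a V"
  shows "\<exists>b\<in>configs. links b V = links a V \<and> b (b y) = y \<and> bad b - {{y, b y}} \<subseteq> bad a - {{x, a x}}"
proof (cases "y = a x")
  case True
  then have "{y, a y} = {x, a x}" "a (a y) = y" using x by auto
  then show ?thesis using a by auto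
next
  case False
  from y obtain t where t: "t \<in> V" "{x, y} = {t, a t}" by (auto simp: links_def)
  have tE: "{x, y} \<in> E" using configD[OF a t(1)] t by simp
  have ay: "a y = x" "x \<noteq> y" using t False edgeD[OF tE] by (auto simp: doubleton_eq_iff)
  let ?b = "a(x := y)"
  have "C \<in> bad a - {{x, a x}}" if C: "C \<in> bad ?b - {{y, ?b y}}" for C
  proof -
    have "x \<notin> C"
    proof
      assume "x \<in> C"
      then have "C = orbit ?b x" using C orbit_cyclic_eq3[of ?b C x] by (auto simp: bad_def)
      moreover have "cyclic_on ?b {x, y}" using two_cycle_iff[of ?b "{x, y}" x] ay by auto
      ultimately have "C = {x, y}" using orbit_cyclic_eq3[of ?b "{x, y}" x] by simp
      then show False using C ay by (auto simp: insert_commute)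
    qed
    then show ?thesis using bad_redirect[of C a x y] C by auto
  qed
  moreover have "links ?b V = links a V" using links_redirect[OF a x] y by (simp add: insert_absorb)
  ultimately show ?thesis using redirect_in_configs[OF a tE] ay by (intro bexI[of _ ?b]) auto
qed

lemma move_two_cycle:
  assumes a: "a \<in> configs" and u: "u \<in> V" "a (a u) = u"
    and reach: "(u, x) \<in> {(p, q). {p, q} \<in> links a V}\<^sup>*"
  shows "x \<in> V \<and> (\<exists>b\<in>configs. links b V = links a V \<and> b (b x) = x \<and>
     bad b - {{x, b x}} \<subseteq> bad a - {{u, a u}})"
  using reach
proof (induction rule: rtrancl_induct)
  case base
  then show ?case using a u by auto
next
  case (step x y)
  then obtain b where b: "b \<in> configs" "links b V = links a V" "b (b x) = x"
      "bad b - {{x, b x}} \<subseteq> bad a - {{u, a u}}" and x: "x \<in> V" by blast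
  have xy: "{x, y} \<in> links b V" using step(2) b(2) by simp
  obtain c where c: "c \<in> configs" "links c V = links b V" "c (c y) = y"
      "bad c - {{y, c y}} \<subseteq> bad b - {{x, b x}}"
    using move_two_cycle_step[OF b(1) x b(3) xy] by blast
  have "\<Union>(links a V) \<subseteq> V" using configD[OF a] by (auto simp: links_def)
  then have "y \<in> V" using step(2) by auto
  then show ?case using c b by (intro conjI bexI[of _ c]) auto
qed

lemma card_links_two_cycle:
  assumes a: "a \<in> configs" and u: "u \<in> V" "a (a u) = u"
  shows "card (links a V) \<le> card V - 1"
proof -
  have "links a V = links a (V - {u})"
  proof -
    have "{u, a u} = {a u, a (a u)}" "a u \<in> V - {u}" using u configD[OF a u(1)] by auto
    then have "{u, a u} \<in> links a (V - {u})" unfolding links_def by blast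
    then show ?thesis using u by (auto simp: links_def)
  qed
  then have "card (links a V) \<le> card (V - {u})"
    using finite_V by (simp add: links_def card_image_le)
  then show ?thesis using u finite_V by simp
qed

lemma missing_edge:
  assumes a: "a \<in> configs" and u: "u \<in> V" "a (a u) = u"
  obtains x y where "(u, x) \<in> {(p, q). {p, q} \<in> links a V}\<^sup>*" "{x, y} \<in> E" "{x, y} \<notin> links a V"
proof -
  let ?R = "{(p, q). {p, q} \<in> links a V}"
  show ?thesis
  proof (cases "\<forall>x\<in>V. (u, x) \<in> ?R\<^sup>*")
    case True
    have "card (links a V) < card E"
      using card_links_two_cycle[OF a u] card_E u(1) finite_V
      by (metis One_nat_def card_gt_0_iff diff_less empty_iff le_less_trans less_le_trans zero_less_one)
    then have "\<not> E \<subseteq> links a V"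
      using card_mono[of "links a V" E] finite_V by (auto simp: links_def)
    then obtain e where e: "e \<in> E" "e \<notin> links a V" by blast
    then have "card e = 2" using simple by (auto simp: simple_graph_def)
    then obtain x y where "e = {x, y}" by (auto simp: card_2_iff)
    then show ?thesis using that[of x y] True e edgeD[of x y] by blast
  next
    case False
    then obtain w where w: "w \<in> V" "(u, w) \<notin> ?R\<^sup>*" by blast
    have "(u, w) \<in> {(x, y). {x, y} \<in> E}\<^sup>*" using connected u w by (auto simp: connected_graph_def)
    then have "\<exists>x y. (u, x) \<in> ?R\<^sup>* \<and> {x, y} \<in> E \<and> (u, y) \<notin> ?R\<^sup>*"
      using w(2)
    proof (induction rule: rtrancl_induct)
      case (step y z)
      then show ?case by (cases "(u, y) \<in> ?R\<^sup>*") auto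
    qed simp
    then obtain x y where xy: "(u, x) \<in> ?R\<^sup>*" "{x, y} \<in> E" "(u, y) \<notin> ?R\<^sup>*" by blast
    then have "{x, y} \<notin> links a V" by (auto dest: rtrancl_into_rtrancl)
    then show ?thesis using that xy by blast
  qed
qed

text \<open>The edges of a configuration with a two-cycle have a tree component. Moving the
  two-cycle along this tree to an end of an unused edge and redirecting an arc along that edge
  adds the edge and destroys the two-cycle.\<close>

lemma remove_two_cycle:
  assumes a: "a \<in> configs" and u: "u \<in> V" "a (a u) = u"
  obtains b f where "b \<in> configs" "f \<notin> links a V" "links b V = insert f (links a V)"
    "bad b \<subseteq> bad a - {{u, a u}}"
proof -
  obtain x y where xy: "(u, x) \<in> {(p, q). {p, q} \<in> links a V}\<^sup>*" "{x, y} \<in> E" "{x, y} \<notin> links a V"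
    using missing_edge[OF a u] by blast
  obtain b where b: "b \<in> configs" "links b V = links a V" "b (b x) = x"
      "bad b - {{x, b x}} \<subseteq> bad a - {{u, a u}}" and x: "x \<in> V"
    using move_two_cycle[OF a u xy(1)] by blast
  let ?c = "b(x := y)"
  have c: "?c \<in> configs" using redirect_in_configs[OF b(1) xy(2)] .
  have links: "links ?c V = insert {x, y} (links a V)" using links_redirect[OF b(1) x b(3)] b(2) by simp
  have other: "C \<in> bad a - {{u, a u}}" if "C \<in> bad ?c" "x \<notin> C" for C
    using bad_redirect[OF that] that b(4) by blast
  show ?thesis
  proof (cases "\<exists>D\<in>bad ?c. x \<in> D")
    case False
    then have "bad ?c \<subseteq> bad a - {{u, a u}}" using other by blast
    then show ?thesis using that[of ?c "{x, y}"] c links xy by blast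
  next
    \<comment> \<open>The new arc may close a cycle in its bad direction. It then passes through
      \<open>x\<close>, and reversing it keeps the edge set.\<close>
    case True
    then obtain D where D: "D \<in> bad ?c" "x \<in> D" by blast
    have cyc: "D \<subseteq> V" "cyclic_on ?c D" using D by (auto simp: bad_def)
    \<comment> \<open>A two-cycle through \<open>x\<close> would need the arc from \<open>y\<close>
      to \<open>x\<close> in \<open>b\<close>, so \<open>{x, y}\<close> would already have been
      used.\<close>
    have "card D \<noteq> 2"
    proof
      assume "card D = 2"
      then have "?c (?c x) = x" using two_cycle_iff[of ?c D x] cyc D by blast
      then have "b y = x" using edgeD[OF xy(2)] by simp
      then have "{x, y} \<in> links b V" using edgeD[OF xy(2)] by (auto simp: links_def image_iff)
      then show False using xy(3) b(2) by simp
    qed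
    then have rev: "bad (reverse ?c D) \<subseteq> bad ?c - {D}" using bad_reverse[OF c D(1)] by blast
    have "bad (reverse ?c D) \<subseteq> bad a - {{u, a u}}"
    proof
      fix C assume "C \<in> bad (reverse ?c D)"
      then have "C \<in> bad ?c" "C \<noteq> D" using rev by auto
      then show "C \<in> bad a - {{u, a u}}" using other[of C] bad_disjoint[OF _ D(1), of C] D(2) by blast
    qed
    then show ?thesis
      using that[of "reverse ?c D" "{x, y}"] reverse_in_configs[OF c cyc] links_reverse[OF cyc(2,1)] links xy
      by simp
  qed
qed

text \<open>Either kind of bad event can be removed without creating another, so a configuration
  with the fewest bad events has none.\<close>

lemma good_config_exists: "\<exists>a\<in>configs. bad a = {}"
proof -
  obtain a where a: "a \<in> configs" and min: "\<And>b. b \<in> configs \<Longrightarrow> card (bad a) \<le> card (bad b)"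
    using configs_nonempty ex_has_least_nat[of "\<lambda>a. a \<in> configs" _ "\<lambda>a. card (bad a)"] by blast
  have "bad a = {}"
  proof (rule ccontr)
    assume "bad a \<noteq> {}"
    then obtain D where D: "D \<in> bad a" by blast
    then obtain s where s: "s \<in> D" using bad_nonempty by blast
    have "\<exists>b\<in>configs. bad b \<subseteq> bad a - {D}"
    proof (cases "card D = 2")
      case True
      then have "D = {s, a s}" "a (a s) = s" "s \<in> V"
        using two_cycle_iff[of a D s] D s by (auto simp: bad_def)
      then show ?thesis using remove_two_cycle[OF a, of s] by metis
    next
      case False
      then show ?thesis using bad_reverse[OF a D] reverse_in_configs[OF a, of D] D by (auto simp: bad_def)
    qed
    then obtain b where b: "b \<in> configs" "bad b \<subseteq> bad a - {D}" by blast
    then have "card (bad b) < card (bad a)" using finite_bad D by (intro psubset_card_mono) auto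
    then show False using min[OF b(1)] by simp
  qed
  then show ?thesis using a by blast
qed

lemma extremal: "extremal_instance V configs bad"
proof
  show "\<And>a C. C \<in> bad a \<Longrightarrow> C \<subseteq> V" by (simp add: bad_def)
qed (use finite_V finite_configs resample_in_configs bad_nonempty bad_cong bad_disjoint
      good_config_exists in blast)+

section \<open>Counting configurations with a single bad event\<close>

definition good :: "('a \<Rightarrow> 'a) set" where "good = {a \<in> configs. bad a = {}}"
definition one_edge :: "('a \<Rightarrow> 'a) set" where
  "one_edge = {a \<in> configs. \<exists>D. bad a = {D} \<and> card D = 2}"
definition one_cycle :: "('a \<Rightarrow> 'a) set" where
  "one_cycle = {a \<in> configs. \<exists>D. bad a = {D} \<and> card D \<noteq> 2}"

lemma finite_good: "finite good" using finite_configs by (simp add: good_def)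

text \<open>On the set \<open>S\<close> of disagreements \<open>b\<close> undoes \<open>a\<close>,
  and \<open>a\<close> maps \<open>S\<close> injectively to itself, so \<open>a\<close> has a cycle
  inside \<open>S\<close> that \<open>b\<close> runs backwards. One of the two directions is bad,
  hence this cycle is bad for \<open>a\<close> or for \<open>b\<close>; but the only bad set
  \<open>D\<close> is a two-cycle of both, on which they agree.\<close>

lemma same_links_unique:
  assumes a: "a \<in> configs" and b: "b \<in> configs" and links: "links a V = links b V"
    and bad: "bad a = {D}" "bad b = {D}" and D: "card D = 2"
  shows "a = b"
proof (rule ccontr)
  assume "a \<noteq> b"
  define S where "S = {s \<in> V. a s \<noteq> b s}"
  have inv: "b (a s) = s" if "s \<in> S" for s
    using links_eqD[of b V a s] links that by (auto simp: S_def)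
  have no_bad: False if "C \<in> bad a \<or> C \<in> bad b" "s \<in> C" "s \<in> S" for C s
  proof -
    have "D \<in> bad a" "D \<in> bad b" "C = D" using that(1) bad by auto
    then have "D = {s, a s}" "D = {s, b s}"
      using two_cycle_iff[of a D s] two_cycle_iff[of b D s] D that(2) by (auto simp: bad_def)
    then show False using that(3) by (auto simp: S_def doubleton_eq_iff)
  qed
  have closed: "a s \<in> S" if s: "s \<in> S" for s
  proof (rule ccontr)
    have sV: "s \<in> V" using s by (simp add: S_def)
    assume "a s \<notin> S"
    then have "a (a s) = s" using inv[OF s] configD[OF a sV] by (simp add: S_def)
    then have "{s, a s} \<in> bad a" using two_cycle_bad[OF a sV] by blast
    then show False using no_bad[of "{s, a s}" s] s by blast
  qed
  have finS: "finite S" using finite_V by (simp add: S_def)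
  have inj: "inj_on a S" using inv by (metis inj_onI)
  have "bij_betw (perm_restrict a S) S S"
    using endo_inj_surj[OF finS _ inj] closed inj
    by (subst bij_betw_cong[of S _ a]) (auto simp: bij_betw_def perm_restrict_def)
  then have perm: "perm_restrict a S permutes S"
    by (rule bij_imp_permutes) (simp add: perm_restrict_def)
  obtain s where s: "s \<in> S"
  proof -
    obtain s where "a s \<noteq> b s" using \<open>a \<noteq> b\<close> by blast
    then have "s \<in> S" using a b by (cases "s \<in> V") (auto simp: S_def configs_iff)
    then show ?thesis by (rule that)
  qed
  define C where "C = orbit (perm_restrict a S) s"
  have CS: "C \<subseteq> S" unfolding C_def using permutes_orbit_subset[OF perm s] .
  then have CV: "C \<subseteq> V" by (auto simp: S_def)
  have cyc: "cyclic_on a C"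
  proof -
    have "perm_restrict a S u = a u" if "u \<in> C" for u
      using that CS by (auto simp: perm_restrict_def)
    then have "cyclic_on (perm_restrict a S) C = cyclic_on a C" by (rule cyclic_cong)
    then show ?thesis using cyclic_on_orbit[OF perm finS, of s, folded C_def] by blast
  qed
  then obtain t where t: "t \<in> C" by (auto simp: cyclic_on_def)
  have tS: "t \<in> S" using t CS by blast
  have notbad: "C \<notin> bad a" "C \<notin> bad b" using no_bad[OF _ t tS] by auto
  then have "card C \<noteq> 2" using CV cyc by (auto simp: bad_def)
  from a CV cyc this show False
  proof (cases rule: orient_cases)
    case 1
    then show False using notbad by blast
  next
    case (2 c)
    \<comment> \<open>Both \<open>b\<close> and \<open>c\<close> invert \<open>a\<close> on
      \<open>C\<close>, so \<open>b\<close> follows the chosen orientation.\<close>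
    have eq: "b u = c u" if u: "u \<in> C" for u
    proof -
      have "c u \<in> C" using cyclic_on_inI[OF 2(1) u] .
      then have "b (a (c u)) = c u" using inv CS by blast
      then show ?thesis using 2(2)[OF u] by simp
    qed
    have "C \<in> bad b"
      using 2 CV cyclic_cong[of C b c] links_cong[of C b c] arcs_cong[of C b c] eq
      by (auto simp: bad_def)
    then show False using notbad by blast
  qed
qed

lemma sum_one_cycle: "(\<Sum>a\<in>one_cycle. card (\<Union>(bad a))) \<le> card good * card V"
proof -
  have fin: "finite one_cycle" using finite_configs by (simp add: one_cycle_def)
  have cyc: "cyclic_on a (\<Union>(bad a))" "\<Union>(bad a) \<subseteq> V" "reverse a (\<Union>(bad a)) \<in> good"
    if "a \<in> one_cycle" for a
  proof -
    obtain D where D: "a \<in> configs" "bad a = {D}" "card D \<noteq> 2"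
      using \<open>a \<in> one_cycle\<close> by (auto simp: one_cycle_def)
    have eq: "\<Union>(bad a) = D" unfolding D(2) by simp
    have DV: "cyclic_on a D" "D \<subseteq> V" "D \<in> bad a" using D(2) by (auto simp: bad_def)
    have "bad (reverse a D) = {}" using bad_reverse[OF D(1) DV(3) D(3)] unfolding D(2) by simp
    then have "reverse a D \<in> good" using reverse_in_configs[OF D(1) DV(2,1)] by (simp add: good_def)
    then show "cyclic_on a (\<Union>(bad a))" "\<Union>(bad a) \<subseteq> V" "reverse a (\<Union>(bad a)) \<in> good"
      unfolding eq using DV by simp_all
  qed
  have fin_Union: "\<forall>a\<in>one_cycle. finite (\<Union>(bad a))"
    using cyc(2) finite_subset[OF _ finite_V] by blast
  let ?f = "\<lambda>(a, v). (reverse a (\<Union>(bad a)), v)"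
  have "(\<Sum>a\<in>one_cycle. card (\<Union>(bad a))) = card (SIGMA a:one_cycle. \<Union>(bad a))"
    using card_SigmaI[OF fin, of "\<lambda>a. \<Union>(bad a)"] fin_Union by simp
  also have "\<dots> \<le> card (good \<times> V)"
  proof (rule card_inj_on_le[of ?f])
    show "inj_on ?f (SIGMA a:one_cycle. \<Union>(bad a))"
    proof (rule inj_onI)
      fix p q assume pq: "p \<in> (SIGMA a:one_cycle. \<Union>(bad a))" "q \<in> (SIGMA a:one_cycle. \<Union>(bad a))"
        and "?f p = ?f q"
      moreover obtain a v where p: "p = (a, v)" by (cases p)
      moreover obtain b w where q: "q = (b, w)" by (cases q)
      ultimately have a: "a \<in> one_cycle" "v \<in> \<Union>(bad a)" and b: "b \<in> one_cycle" "v \<in> \<Union>(bad b)"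
        and rev: "reverse a (\<Union>(bad a)) = reverse b (\<Union>(bad b))" and vw: "v = w"
        by (simp_all only: prod.case prod.inject mem_Sigma_iff)
      let ?D = "\<Union>(bad a)"
      \<comment> \<open>The marked vertex remembers which cycle was reversed: its orbit is unchanged
        as a set.\<close>
      have "?D = orbit (reverse a ?D) v"
        using orbit_cyclic_eq3[OF cyclic_on_reverse_self[OF cyc(1)[OF a(1)]] a(2)] by simp
      also have "\<dots> = \<Union>(bad b)"
        using orbit_cyclic_eq3[OF cyclic_on_reverse_self[OF cyc(1)[OF b(1)]] b(2)] rev by simp
      finally have eq: "?D = \<Union>(bad b)" .
      have "a = b"
        using reverse_eqD[OF cyc(1)[OF a(1)], of b] cyc(1)[OF b(1)] rev unfolding eq by blast
      then show "p = q" using p q vw by simp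
    qed
    show "?f ` (SIGMA a:one_cycle. \<Union>(bad a)) \<subseteq> good \<times> V"
    proof (rule image_subsetI, elim SigmaE, simp only: prod.case mem_Times_iff fst_conv snd_conv)
      fix a v assume a: "a \<in> one_cycle" "v \<in> \<Union>(bad a)"
      show "reverse a (\<Union>(bad a)) \<in> good \<and> v \<in> V" using cyc(2,3)[OF a(1)] a(2) by blast
    qed
    show "finite (good \<times> V)" using finite_good finite_V by simp
  qed
  finally show ?thesis by (simp only: card_cartesian_product)
qed

lemma one_edgeD:
  assumes "a \<in> one_edge"
  obtains u where "a \<in> configs" "u \<in> V" "a (a u) = u" "bad a = {{u, a u}}" "card {u, a u} = 2"
proof -
  obtain D where D: "a \<in> configs" "bad a = {D}" "card D = 2" using assms by (auto simp: one_edge_def)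
  then have "D \<in> bad a" by simp
  then have cyc: "D \<subseteq> V" "cyclic_on a D" by (auto simp: bad_def)
  then obtain u where u: "u \<in> D" by (auto simp: cyclic_on_def)
  then show ?thesis using that[of u] two_cycle_iff[of a D u] cyc D by auto
qed

lemma card_one_edge: "card one_edge \<le> (card V - 1) * (card good * card V)"
proof -
  define \<F> where "\<F> = (\<lambda>a. links a V) ` one_edge"
  have fin: "finite one_edge" using finite_configs by (simp add: one_edge_def)
  have finL: "finite F" if "F \<in> \<F>" for F using that finite_V by (auto simp: \<F>_def links_def)
  have finF: "finite \<F>" using fin by (simp add: \<F>_def)
  \<comment> \<open>The deleted edge is named by a vertex \<open>z\<close> whose arc in
    \<open>b\<close> uses it, so each good configuration accounts for at most \<open>card V\<close>
    edge sets.\<close>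
  have "\<F> \<subseteq> (\<lambda>(b, z). links b V - {{z, b z}}) ` (good \<times> V)"
  proof
    fix F assume "F \<in> \<F>"
    then obtain a where a: "a \<in> one_edge" "F = links a V" by (auto simp: \<F>_def)
    obtain u where u: "a \<in> configs" "u \<in> V" "a (a u) = u" "bad a = {{u, a u}}"
      using one_edgeD[OF a(1)] by blast
    obtain b f where b: "b \<in> configs" "f \<notin> links a V" "links b V = insert f (links a V)"
        "bad b \<subseteq> bad a - {{u, a u}}"
      using remove_two_cycle[OF u(1-3)] by blast
    then have "b \<in> good" using u(4) by (auto simp: good_def)
    moreover obtain z where "z \<in> V" "f = {z, b z}"
    proof -
      have "f \<in> links b V" using b(3) by simp
      then show ?thesis using that by (auto simp: links_def)
    qed
    moreover have "F = links b V - {f}" using b a by auto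
    ultimately show "F \<in> (\<lambda>(b, z). links b V - {{z, b z}}) ` (good \<times> V)"
      by (intro image_eqI[of _ _ "(b, z)"]) simp_all
  qed
  then have "card \<F> \<le> card (good \<times> V)"
    using finite_good finite_V by (intro surj_card_le) auto
  then have card_F: "card \<F> \<le> card good * card V" by (simp only: card_cartesian_product)
  have "card one_edge \<le> card (SIGMA F:\<F>. F)"
  proof (rule card_inj_on_le[of "\<lambda>a. (links a V, \<Union>(bad a))"])
    show "inj_on (\<lambda>a. (links a V, \<Union>(bad a))) one_edge"
    proof (rule inj_onI)
      fix a b assume ab: "a \<in> one_edge" "b \<in> one_edge"
        and eq: "(links a V, \<Union>(bad a)) = (links b V, \<Union>(bad b))"
      obtain C D where C: "a \<in> configs" "bad a = {C}" "card C = 2" and D: "b \<in> configs" "bad b = {D}"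
        using ab by (auto simp: one_edge_def)
      then have "C = D" using eq by simp
      then show "a = b" using same_links_unique[of a b C] C D eq by simp
    qed
    show "(\<lambda>a. (links a V, \<Union>(bad a))) ` one_edge \<subseteq> (SIGMA F:\<F>. F)"
    proof (rule image_subsetI)
      fix a assume a: "a \<in> one_edge"
      obtain u where u: "u \<in> V" "bad a = {{u, a u}}" by (rule one_edgeD[OF a])
      then have "\<Union>(bad a) \<in> links a V" by (auto simp: links_def)
      then show "(links a V, \<Union>(bad a)) \<in> (SIGMA F:\<F>. F)" using a by (auto simp: \<F>_def)
    qed
    show "finite (SIGMA F:\<F>. F)" using finF finL by (rule finite_SigmaI)
  qed
  also have "\<dots> = (\<Sum>F\<in>\<F>. card F)" using finF finL by (subst card_SigmaI) auto
  also have "\<dots> \<le> (\<Sum>F\<in>\<F>. card V - 1)"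
  proof (rule sum_mono)
    fix F assume "F \<in> \<F>"
    then obtain a where a: "a \<in> one_edge" "F = links a V" by (auto simp: \<F>_def)
    obtain u where "a \<in> configs" "u \<in> V" "a (a u) = u" by (rule one_edgeD[OF a(1)])
    then show "card F \<le> card V - 1" unfolding a(2) by (rule card_links_two_cycle)
  qed
  also have "\<dots> \<le> (card V - 1) * (card good * card V)" using card_F by simp
  finally show ?thesis .
qed

lemma single_weight_le:
  "extremal_instance.single_weight configs bad {} / extremal_instance.good_weight configs bad {}
     \<le> 2 * real (card V) ^ 2 - real (card V)"
proof -
  interpret extremal_instance V configs bad by (rule extremal)
  have far: "far {} a = bad a" for a by (simp add: far_def)
  have good: "good_weight {} = card good"
    using finite_configs by (simp add: good_weight_def far good_def of_bool_def sum.If_cases Int_def)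
  have "single_weight {} = (\<Sum>a\<in>one_cycle \<union> one_edge. real (card (\<Union>(bad a))))"
    unfolding single_weight_def far
    by (rule sum.mono_neutral_cong_right)
      (auto simp: finite_configs one_cycle_def one_edge_def card_1_singleton_iff)
  also have "\<dots> = (\<Sum>a\<in>one_cycle. real (card (\<Union>(bad a)))) + (\<Sum>a\<in>one_edge. real (card (\<Union>(bad a))))"
    using finite_configs by (intro sum.union_disjoint) (auto simp: one_cycle_def one_edge_def)
  also have "\<dots> \<le> real (card good * card V) + 2 * real ((card V - 1) * (card good * card V))"
  proof (rule add_mono)
    have "real (\<Sum>a\<in>one_cycle. card (\<Union>(bad a))) \<le> real (card good * card V)"
      using sum_one_cycle by (rule of_nat_mono)
    then show "(\<Sum>a\<in>one_cycle. real (card (\<Union>(bad a)))) \<le> real (card good * card V)"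
      unfolding of_nat_sum .
    have "(\<Sum>a\<in>one_edge. real (card (\<Union>(bad a)))) = (\<Sum>a\<in>one_edge. 2)"
      by (rule sum.cong) (auto simp: one_edge_def)
    also have "\<dots> = 2 * real (card one_edge)" by simp
    also have "\<dots> \<le> 2 * real ((card V - 1) * (card good * card V))"
      by (intro mult_left_mono of_nat_mono card_one_edge) simp
    finally show "(\<Sum>a\<in>one_edge. real (card (\<Union>(bad a)))) \<le> 2 * real ((card V - 1) * (card good * card V))" .
  qed
  also have "\<dots> = (2 * real (card V) ^ 2 - real (card V)) * real (card good)"
  proof -
    \<comment> \<open>Nonemptiness turns the truncated subtraction into a real one; the two
      contributions then add up as \<open>n + 2 (n - 1) n = 2 n^2 - n\<close> with
      \<open>n = card V\<close>.\<close>
    have "card V \<ge> 1" using connected finite_V by (simp add: connected_graph_def Suc_le_eq card_gt_0_iff)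
    then have "real (card V - 1) = real (card V) - 1" by simp
    then show ?thesis by (simp add: power2_eq_square algebra_simps)
  qed
  finally show ?thesis using good_weight_pos[of "{}"] by (simp add: good pos_divide_le_eq)
qed

end

theorem theorem3p4:
  fixes V :: "'a set" and E :: "'a set set"
    and orient :: "'a set set \<Rightarrow> ('a \<times> 'a) set"
  assumes "simple_graph V E" and "connected_graph V E" and "card E \<ge> card V"
    and "cycle_orientation E orient"
  shows "(\<integral>\<^sup>+ \<omega>. num_resampled E orient \<omega> \<partial>sample_space V E)
           \<le> ennreal (2 * real (card V) ^ 2 - real (card V))"
proof -
  interpret bicycle_graph V E orient
    using assms by unfold_locales
  show ?thesis
    using nn_integral_num_resampled_le[OF extremal Bad_eq arc_pmf_configs]
      ennreal_leI[OF single_weight_le] by (rule order_trans)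
qed

end
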